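(* Every strongly perfect quadratic function (lying in the positive Erdahl cone) is extreme.
   Context: A quadratic function in $n$ variables is $f(x)=\alpha_f+2b_f\cdot x+Q_f[x]$ with $\alpha_f\in\mathbb{R}$, $b_f\in\mathbb{R}^n$, $Q_f$ real symmetric, $Q[x]=x^tQx$. The positive Erdahl cone $\mathcal{E}_{>0}$ is the set of $f$ with $f(v)\ge0$ for all $v\in\mathbb{Z}^n$ and $Q_f$ positive definite. For $f\in\mathcal{E}_{>0}$: $\mu(f)=-\min_xf(x)$, $H(f)=\mu(f)/(\det Q_f)^{1/n}$, $\mathrm{Del}\,f=\mathrm{conv}\{v\in\mathbb{Z}^n: f(v)=0\}$. $f$ is extreme if it is a local maximum of $H$ on $\mathcal{E}_{>0}$. A finite set $X\subset\mathbb{R}^n$ carries a spherical $t$-design with respect to a PQF $Q$ if there are $c\in\mathbb{R}^n$, $r>0$ with $X\subset S_Q(c,r)=\{x: Q[x-c]=r^2\}$ and $\frac{1}{|X|}\sum_{x\in X}p(x)=\int_{S_Q(c,r)}p\,d\omega$ for every polynomial $p$ of degree at most $t$, where $\omega$ is the normalized surface measure on $S_Q(c,r)$ (the image of the normalized rotation-invariant measure on the unit sphere under $y\mapsto c+rQ^{-1/2}y$). $f\in\mathcal{E}_{>0}$ is strongly perfect if the vertex set of $\mathrm{Del}\,f$ carries a spherical $4$-design with respect to $Q_f$. *)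

theory Defs
  imports "HOL-Probability.Probability"
begin

section \<open>Quadratic functions and the positive Erdahl cone\<close>

text \<open>
  The triple \<open>(\<alpha>, b, Q)\<close> stands for the function \<open>x \<mapsto> \<alpha> + 2 b\<cdot>x + Q[x]\<close>.
  For symmetric \<open>Q\<close> the function determines the triple. The product type carries the topology
  of the (finite-dimensional) coefficient space, in which local maxima are taken; symmetry
  of \<open>Q\<close> is imposed in the definition of the Erdahl cone.
\<close>

type_synonym 'n quadratic = "real \<times> (real^'n) \<times> (real^'n^'n)"

definition const_part :: "'n quadratic \<Rightarrow> real" where
  "const_part f = fst f"

definition lin_part :: "'n quadratic \<Rightarrow> real^'n" where
  "lin_part f = fst (snd f)"

definition quad_part :: "'n quadratic \<Rightarrow> real^'n^'n" where
  "quad_part f = snd (snd f)"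

definition quad_form :: "real^'n^'n \<Rightarrow> real^'n \<Rightarrow> real" where
  "quad_form Q x = x \<bullet> (Q *v x)"

definition eval_quadratic :: "'n::finite quadratic \<Rightarrow> real^'n \<Rightarrow> real" where
  "eval_quadratic f x = const_part f + 2 * (lin_part f \<bullet> x) + quad_form (quad_part f) x"

definition positive_definite :: "real^'n^'n \<Rightarrow> bool" where
  "positive_definite Q \<longleftrightarrow> transpose Q = Q \<and> (\<forall>x. x \<noteq> 0 \<longrightarrow> quad_form Q x > 0)"

definition int_lattice :: "(real^'n) set" where
  "int_lattice = {v. \<forall>i. v $ i \<in> \<int>}"

definition erdahl_pos :: "'n::finite quadratic set" where
  "erdahl_pos = {f. (\<forall>v\<in>int_lattice. eval_quadratic f v \<ge> 0) \<and> positive_definite (quad_part f)}"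

text \<open>On \<open>erdahl_pos\<close> the infimum below is attained, i.e. it is the minimum over all of
  \<open>\<real>\<^sup>n\<close>.\<close>

definition mu :: "'n::finite quadratic \<Rightarrow> real" where
  "mu f = - (INF x. eval_quadratic f x)"

definition H :: "'n::finite quadratic \<Rightarrow> real" where
  "H f = mu f / root CARD('n) (det (quad_part f))"

definition Del :: "'n::finite quadratic \<Rightarrow> (real^'n) set" where
  "Del f = convex hull {v \<in> int_lattice. eval_quadratic f v = 0}"

definition extreme :: "'n::finite quadratic \<Rightarrow> bool" where
  "extreme f \<longleftrightarrow> f \<in> erdahl_pos \<and> (\<forall>\<^sub>F g in at f within erdahl_pos. H g \<le> H f)"


section \<open>Spherical designs with respect to a positive definite quadratic form\<close>

text \<open>Polynomial functions on \<open>\<real>\<^sup>n\<close> of total degree at most \<open>t\<close>; \<open>k\<close> runs over the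
  (finitely many, see below) exponent vectors.\<close>

definition poly_fun_deg_le :: "nat \<Rightarrow> (real^'n::finite \<Rightarrow> real) \<Rightarrow> bool" where
  "poly_fun_deg_le t p \<longleftrightarrow>
     (\<exists>a :: ('n \<Rightarrow> nat) \<Rightarrow> real.
        \<forall>x. p x = (\<Sum>k\<in>{k. (\<Sum>i\<in>UNIV. k i) \<le> t}. a k * (\<Prod>i\<in>UNIV. (x $ i) ^ k i)))"

lemma finite_exponents: "finite {k :: 'n::finite \<Rightarrow> nat. (\<Sum>i\<in>UNIV. k i) \<le> t}"
proof (rule finite_subset)
  have "k i \<le> t" if "sum k UNIV \<le> t" for k :: "'n \<Rightarrow> nat" and i
    using member_le_sum[of i UNIV k] that by simp
  then show "{k :: 'n \<Rightarrow> nat. (\<Sum>i\<in>UNIV. k i) \<le> t} \<subseteq> Pi\<^sub>E UNIV (\<lambda>_. {..t})"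
    by auto
qed (simp add: finite_PiE)

text \<open>
  The rotation-invariant probability measure on the unit sphere, as a Borel measure
  on \<open>\<real>\<^sup>n\<close>: the radial projection of the uniform distribution on the unit ball. That it
  is a probability measure, lives on the sphere and is invariant under all orthogonal
  transformations is proved below; these properties characterise it.
\<close>

definition unit_sphere_measure :: "(real^'n::finite) measure" where
  "unit_sphere_measure =
     distr (uniform_measure lborel (ball 0 1)) borel (\<lambda>x. x /\<^sub>R norm x)"

lemma emeasure_unit_sphere_measure:
  fixes A :: "(real^'n::finite) set"
  assumes "A \<in> sets borel"
  shows "emeasure unit_sphere_measure A =
    emeasure lborel (ball 0 1 \<inter> (\<lambda>x. x /\<^sub>R norm x) -` A) / emeasure lborel (ball (0 :: real^'n) 1)"
proof -
  have [measurable]: "(\<lambda>x::real^'n. x /\<^sub>R norm x) \<in> borel_measurable borel" by measurable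
  have "(\<lambda>x::real^'n. x /\<^sub>R norm x) -` A \<in> sets borel"
    using measurable_sets_borel[OF _ assms, of "\<lambda>x::real^'n. x /\<^sub>R norm x"] by simp
  then show ?thesis
    using assms by (simp add: unit_sphere_measure_def emeasure_distr)
qed

lemma unit_ball_emeasure:
  "emeasure lborel (ball (0 :: 'a::euclidean_space) 1) \<noteq> 0"
  "emeasure lborel (ball (0 :: 'a::euclidean_space) 1) \<noteq> \<infinity>"
proof -
  show "emeasure lborel (ball (0 :: 'a::euclidean_space) 1) \<noteq> \<infinity>"
    using emeasure_lborel_ball_finite[of "0::'a" 1] by auto
  show "emeasure lborel (ball (0 :: 'a::euclidean_space) 1) \<noteq> 0"
    using content_ball_pos[of 1 "0::'a"] by (auto simp: measure_def)
qed
lemma distr_lborel_orthogonal: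
  fixes g :: "'a::euclidean_space \<Rightarrow> 'a"
  assumes g: "orthogonal_transformation g"
  shows "distr lborel borel g = lborel"
proof (rule measure_eqI)
  fix A assume "A \<in> sets (distr lborel borel g)"
  then have A[measurable]: "A \<in> sets borel" by simp
  have lin: "linear g" and nrm: "norm (g x) = norm x" for x
    using g by (auto simp: orthogonal_transformation_linear orthogonal_transformation_norm)
  have gm[measurable]: "g \<in> borel_measurable borel"
    using lin by (intro borel_measurable_continuous_onI linear_continuous_on) (simp add: linear_conv_bounded_linear)
  let ?M = "distr lborel borel g" and ?B = "ball (0::'a) 1"
  have shift: "(\<integral>\<^sup>+x. h (x + y) \<partial>lborel) = (\<integral>\<^sup>+x. h x \<partial>lborel)"
    if [measurable]: "h \<in> borel_measurable borel" for h :: "'a \<Rightarrow> ennreal" and y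
    by (subst (2) lborel_distr_plus[symmetric, of y])
       (simp add: nn_integral_distr add.commute)
  have reflect: "(\<integral>\<^sup>+x. h (y - x) \<partial>lborel) = (\<integral>\<^sup>+x. h x \<partial>lborel)"
    if [measurable]: "h \<in> borel_measurable borel" for h :: "'a \<Rightarrow> ennreal" and y
    by (subst (2) lborel_affine[of "-1" y])
       (simp_all add: nn_integral_density nn_integral_distr)
  define a where "a = (indicator A :: 'a \<Rightarrow> ennreal)"
  define b where "b = (indicator ?B :: 'a \<Rightarrow> ennreal)"
  have [measurable]: "a \<in> borel_measurable borel" "b \<in> borel_measurable borel"
    unfolding a_def b_def by (intro borel_measurable_indicator; simp)+
  have "emeasure lborel ?B * emeasure ?M A = (\<integral>\<^sup>+y. b y \<partial>lborel) * (\<integral>\<^sup>+x. a x \<partial>?M)"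
    by (simp add: a_def b_def)
  also have "\<dots> = (\<integral>\<^sup>+x. (\<integral>\<^sup>+y. b y \<partial>lborel) * a (g x) \<partial>lborel)"
    by (subst nn_integral_distr) (simp_all add: nn_integral_cmult)
  also have "\<dots> = (\<integral>\<^sup>+x. \<integral>\<^sup>+y. b (y + g x) * a (g x) \<partial>lborel \<partial>lborel)"
  proof (rule nn_integral_cong)
    fix x
    have "(\<integral>\<^sup>+y. b (y + g x) * a (g x) \<partial>lborel) = (\<integral>\<^sup>+y. b (y + g x) \<partial>lborel) * a (g x)"
      by (rule nn_integral_multc) measurable
    also have "(\<integral>\<^sup>+y. b (y + g x) \<partial>lborel) = (\<integral>\<^sup>+y. b y \<partial>lborel)"
      by (rule shift) measurable
    finally show "(\<integral>\<^sup>+y. b y \<partial>lborel) * a (g x) = (\<integral>\<^sup>+y. b (y + g x) * a (g x) \<partial>lborel)" ..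
  qed
  also have "\<dots> = (\<integral>\<^sup>+y. \<integral>\<^sup>+x. b (y + g x) * a (g x) \<partial>lborel \<partial>lborel)"
    by (rule lborel_pair.Fubini') measurable
  also have "\<dots> = (\<integral>\<^sup>+y. \<integral>\<^sup>+x. b (g x) * a (g x - y) \<partial>lborel \<partial>lborel)"
  proof (rule nn_integral_cong)
    fix y
    obtain z where z: "g z = y"
      using orthogonal_transformation_surj[OF g] by (metis surjD)
    have "(\<integral>\<^sup>+x. b (g (x + z)) * a (g (x + z) - y) \<partial>lborel) = (\<integral>\<^sup>+x. b (g x) * a (g x - y) \<partial>lborel)"
      by (rule shift[of "\<lambda>x. b (g x) * a (g x - y)" z]) measurable
    then show "(\<integral>\<^sup>+x. b (y + g x) * a (g x) \<partial>lborel) = (\<integral>\<^sup>+x. b (g x) * a (g x - y) \<partial>lborel)"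
      by (simp add: linear_add[OF lin] z add.commute)
  qed
  also have "\<dots> = (\<integral>\<^sup>+x. \<integral>\<^sup>+y. b (g x) * a (g x - y) \<partial>lborel \<partial>lborel)"
    by (rule lborel_pair.Fubini'[symmetric]) measurable
  also have "\<dots> = (\<integral>\<^sup>+x. b (g x) * (\<integral>\<^sup>+y. a y \<partial>lborel) \<partial>lborel)"
  proof (rule nn_integral_cong)
    fix x
    have "(\<integral>\<^sup>+y. b (g x) * a (g x - y) \<partial>lborel) = b (g x) * (\<integral>\<^sup>+y. a (g x - y) \<partial>lborel)"
      by (rule nn_integral_cmult) measurable
    also have "(\<integral>\<^sup>+y. a (g x - y) \<partial>lborel) = (\<integral>\<^sup>+y. a y \<partial>lborel)"
      by (rule reflect) measurable
    finally show "(\<integral>\<^sup>+y. b (g x) * a (g x - y) \<partial>lborel) = b (g x) * (\<integral>\<^sup>+y. a y \<partial>lborel)" .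
  qed
  also have "\<dots> = (\<integral>\<^sup>+x. b x * (\<integral>\<^sup>+y. a y \<partial>lborel) \<partial>lborel)"
    by (intro nn_integral_cong) (simp add: b_def indicator_def nrm)
  also have "\<dots> = emeasure lborel ?B * emeasure lborel A"
    by (simp add: nn_integral_multc) (simp add: a_def b_def)
  finally show "emeasure ?M A = emeasure lborel A"
    using unit_ball_emeasure[where 'a='a] by (simp add: ennreal_mult_cancel_left)
qed simp

lemma prob_space_unit_sphere_measure: "prob_space (unit_sphere_measure :: (real^'n::finite) measure)"
  unfolding unit_sphere_measure_def
  by (intro prob_space.prob_space_distr prob_space_uniform_measure unit_ball_emeasure) measurable

lemma unit_sphere_measure_sphere:
  "emeasure unit_sphere_measure (sphere (0 :: real^'n::finite) 1) = 1"
proof -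
  have "emeasure lborel (ball 0 1 \<inter> (\<lambda>x::real^'n. x /\<^sub>R norm x) -` sphere 0 1)
      = emeasure lborel (ball (0::real^'n) 1 - {0})"
    by (rule arg_cong[where f = "emeasure lborel"]) auto
  also have "\<dots> = emeasure lborel (ball (0::real^'n) 1)"
    by (intro emeasure_Diff_null_set) auto
  finally show ?thesis
    using unit_ball_emeasure[where 'a="real^'n"]
    by (simp add: emeasure_unit_sphere_measure top.not_eq_extremum zero_less_iff_neq_zero)
qed

lemma unit_sphere_measure_invariant:
  fixes g :: "real^'n::finite \<Rightarrow> real^'n"
  assumes g: "orthogonal_transformation g"
  shows "distr unit_sphere_measure borel g = unit_sphere_measure"
proof (rule measure_eqI)
  show "sets (distr unit_sphere_measure borel g) = sets unit_sphere_measure"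
    by (simp add: unit_sphere_measure_def)
next
  fix A assume "A \<in> sets (distr unit_sphere_measure borel g)"
  then have A: "A \<in> sets borel" by simp
  have lin: "linear g" and nrm: "norm (g x) = norm x" for x
    using g by (auto simp: orthogonal_transformation_linear orthogonal_transformation_norm)
  have [measurable]: "g \<in> borel_measurable borel"
    using lin by (intro borel_measurable_continuous_onI linear_continuous_on) (simp add: linear_conv_bounded_linear)
  let ?S = "\<lambda>A. ball 0 1 \<inter> (\<lambda>x::real^'n. x /\<^sub>R norm x) -` A"
  have S: "?S A \<in> sets borel"
    using measurable_sets_borel[OF _ A, of "\<lambda>x::real^'n. x /\<^sub>R norm x"] by simp
  have gA: "g -` A \<in> sets borel" using measurable_sets_borel[OF _ A, of g] by simp
  have "emeasure lborel (?S A) = emeasure (distr lborel borel g) (?S A)"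
    by (simp add: distr_lborel_orthogonal[OF g])
  also have "\<dots> = emeasure lborel (g -` ?S A)"
    using S by (simp add: emeasure_distr)
  also have "g -` ?S A = ?S (g -` A)"
    by (auto simp: nrm linear_cmul[OF lin])
  finally have "emeasure lborel (?S A) = emeasure lborel (?S (g -` A))" .
  moreover have "emeasure (distr unit_sphere_measure borel g) A
      = emeasure unit_sphere_measure (g -` A)"
    using A by (subst emeasure_distr) (auto simp: unit_sphere_measure_def)
  ultimately show "emeasure (distr unit_sphere_measure borel g) A = emeasure unit_sphere_measure A"
    using A gA by (simp add: emeasure_unit_sphere_measure)
qed

text \<open>\<open>Q\<^sup>1\<^sup>/\<^sup>2\<close> for positive definite \<open>Q\<close>: the unique positive definite square root.\<close>

definition matrix_sqrt :: "real^'n::finite^'n \<Rightarrow> real^'n^'n" where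
  "matrix_sqrt Q = (THE S. positive_definite S \<and> S ** S = Q)"

definition ellipsoid :: "real^'n^'n \<Rightarrow> real^'n \<Rightarrow> real \<Rightarrow> (real^'n) set" where
  "ellipsoid Q c r = {x. quad_form Q (x - c) = r\<^sup>2}"

definition ellipsoid_measure :: "real^'n::finite^'n \<Rightarrow> real^'n \<Rightarrow> real \<Rightarrow> (real^'n) measure" where
  "ellipsoid_measure Q c r =
     distr unit_sphere_measure borel (\<lambda>y. c + r *\<^sub>R (matrix_inv (matrix_sqrt Q) *v y))"

text \<open>Taking \<open>p = 1\<close> shows that the empty set does not carry a design.\<close>

definition carries_spherical_design :: "nat \<Rightarrow> real^'n::finite^'n \<Rightarrow> (real^'n) set \<Rightarrow> bool" where
  "carries_spherical_design t Q X \<longleftrightarrow>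
     finite X \<and>
     (\<exists>c r. r > 0 \<and> X \<subseteq> ellipsoid Q c r \<and>
        (\<forall>p. poly_fun_deg_le t p \<longrightarrow>
           (1 / real (card X)) * (\<Sum>x\<in>X. p x) = (\<integral>x. p x \<partial>ellipsoid_measure Q c r)))"

definition strongly_perfect :: "'n::finite quadratic \<Rightarrow> bool" where
  "strongly_perfect f \<longleftrightarrow>
     f \<in> erdahl_pos \<and>
     carries_spherical_design 4 (quad_part f) {v. v extreme_point_of Del f}"

end

theory Submission
  imports Defs
begin

text \<open>
  Pull back along \<open>y \<mapsto> c + r Q\<^sup>-\<^sup>1\<^sup>/\<^sup>2 y\<close>, so that the vertices form a finite set \<open>Y\<close> on the unit sphere.
  A quadratic function vanishing on \<open>Y\<close> has square of mean \<open>0\<close> over \<open>Y\<close>, hence, the square having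
  degree \<open>4\<close>, also over the sphere, so it vanishes on the sphere and is a multiple of
  \<open>\<bar>y\<bar>\<^sup>2 - 1\<close>; in particular so is \<open>f\<close>. As \<open>H\<close> is invariant under positive scaling, a function of
  the cone near \<open>f\<close> may be written as \<open>\<bar>y\<bar>\<^sup>2 - 1 + q(y)\<close>, where \<open>q = \<delta> + 2\<gamma>\<cdot>y + N[y]\<close> is small with
  \<open>tr N = 0\<close> and nonnegative on \<open>Y\<close>. The mean of \<open>q\<close> over \<open>Y\<close> is \<open>\<delta>\<close>, and \<open>q\<close> is determined by its
  values on \<open>Y\<close>, so \<open>\<bar>q\<bar> \<le> K\<delta>\<close>. Now \<open>\<mu> \<le> 1 - \<delta> + O(\<bar>q\<bar>\<^sup>2)\<close> while \<open>det (1 + N) \<ge> 1 - O(\<bar>q\<bar>\<^sup>2)\<close>: the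
  first-order loss \<open>\<delta>\<close> dominates all quadratic errors.
\<close>

section \<open>Positive definite matrices and their square roots\<close>

lemma scaleR_matrix_vector: "(k *\<^sub>R A) *v x = k *\<^sub>R (A *v x)" for A :: "real^'n^'m"
  by (simp add: scaleR_matrix_vector_assoc)

lemma scaleR_matrix_mult_left: "(k *\<^sub>R A) ** B = k *\<^sub>R (A ** B)" for A :: "real^'n^'m" and B :: "real^'p^'n"
  by (simp add: vec_eq_iff matrix_matrix_mult_def sum_distrib_left mult.assoc)

lemma scaleR_matrix_mult_right: "A ** (k *\<^sub>R B) = k *\<^sub>R (A ** B)" for A :: "real^'n^'m" and B :: "real^'p^'n"
  by (simp add: vec_eq_iff matrix_matrix_mult_def sum_distrib_left mult.left_commute)

lemma symmetric_matrix_inner_swap: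
  fixes A :: "real^'n^'n"
  assumes "transpose A = A"
  shows "x \<bullet> (A *v y) = (A *v x) \<bullet> y"
  by (metis assms dot_lmul_matrix transpose_matrix_vector)

lemma symmetric_matrix_iff_inner:
  fixes A :: "real^'n^'n"
  shows "transpose A = A \<longleftrightarrow> (\<forall>x y. x \<bullet> (A *v y) = (A *v x) \<bullet> y)"
proof
  assume *: "\<forall>x y. x \<bullet> (A *v y) = (A *v x) \<bullet> y"
  show "transpose A = A"
  proof (rule matrix_eq[THEN iffD2], rule allI)
    fix x
    have "(transpose A *v x) \<bullet> y = (A *v x) \<bullet> y" for y
      using * by (simp add: dot_lmul_matrix)
    then show "transpose A *v x = A *v x"
      by (metis vector_eq_rdot)
  qed
qed (simp add: symmetric_matrix_inner_swap)

lemma quad_form_scaleR_vec: "quad_form Q (k *\<^sub>R x) = k\<^sup>2 * quad_form Q x"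
  by (simp add: quad_form_def matrix_vector_mult_scaleR power2_eq_square)

lemma quad_form_scaleR: "quad_form (k *\<^sub>R Q) x = k * quad_form Q x"
  by (simp add: quad_form_def scaleR_matrix_vector)

lemma quad_form_add: "quad_form (P + Q) x = quad_form P x + quad_form Q x"
  by (simp add: quad_form_def matrix_vector_mult_add_rdistrib inner_add_right)

lemma quad_form_diff: "quad_form (P - Q) x = quad_form P x - quad_form Q x"
  by (simp add: quad_form_def matrix_vector_mult_diff_rdistrib inner_diff_right)

lemma quad_form_mat_1: "quad_form (mat 1) x = (norm x)\<^sup>2"
  by (simp add: quad_form_def dot_square_norm)

lemma quad_form_congruence:
  "transpose T = T \<Longrightarrow> quad_form P (T *v x) = quad_form (T ** P ** T) x"
  by (simp add: quad_form_def matrix_vector_mul_assoc[symmetric] symmetric_matrix_inner_swap)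

lemma quad_form_polarization:
  assumes "transpose A = A"
  shows "4 * (x \<bullet> (A *v y)) = quad_form A (x + y) - quad_form A (x - y)"
  using symmetric_matrix_inner_swap[OF assms, of x y]
  by (simp add: quad_form_def algebra_simps inner_commute)

lemma symmetric_matrix_eq_0:
  assumes "transpose A = A" "\<And>x. quad_form A x = 0"
  shows "A = 0"
proof -
  have "x \<bullet> (A *v y) = 0" for x y
    using quad_form_polarization[OF assms(1), of x y] assms(2) by simp
  then have "A *v y = 0" for y
    by (metis inner_eq_zero_iff)
  then show ?thesis
    by (simp add: matrix_eq)
qed

lemma continuous_quad_form [continuous_intros]:
  "continuous_on A f \<Longrightarrow> continuous_on A (\<lambda>x. quad_form Q (f x))"
  unfolding quad_form_def
  by (intro continuous_intros bounded_linear.continuous_on[OF matrix_vector_mul_bounded_linear])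

text \<open>Polarization is applied to x and the multiple u of Ax that has the length of x: the
  inner product of u and Ax is |x||Ax|, and the parallelogram law bounds the two values of the form
  by q times a multiple of |x|^2.\<close>

lemma symmetric_matrix_norm_bound:
  assumes sym: "transpose A = A" and q: "\<And>x. \<bar>quad_form A x\<bar> \<le> q * (norm x)\<^sup>2"
  shows "norm (A *v x) \<le> q * norm x"
proof (cases "A *v x = 0")
  case True
  have "0 \<le> q * (norm x)\<^sup>2" using q[of x] by linarith
  then show ?thesis using True
    by (cases "x = 0") (simp_all add: zero_le_mult_iff)
next
  case False
  define u where "u = (norm x / norm (A *v x)) *\<^sub>R (A *v x)"
  have u: "norm u = norm x" using False by (simp add: u_def)
  have "x \<noteq> 0" using False by auto
  have "4 * (u \<bullet> (A *v x)) \<le> q * (norm (u + x))\<^sup>2 + q * (norm (u - x))\<^sup>2"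
    using q[of "u + x"] q[of "u - x"] unfolding quad_form_polarization[OF sym] by linarith
  also have "\<dots> = q * (2 * (norm u)\<^sup>2 + 2 * (norm x)\<^sup>2)"
    by (simp add: power2_norm_eq_inner algebra_simps)
  also have "\<dots> = 4 * (q * (norm x)\<^sup>2)" by (simp add: u)
  finally have "u \<bullet> (A *v x) \<le> q * (norm x)\<^sup>2" by simp
  moreover have "u \<bullet> (A *v x) = norm x * norm (A *v x)"
    using False by (simp add: u_def dot_square_norm power2_eq_square)
  ultimately have "norm x * norm (A *v x) \<le> norm x * (q * norm x)"
    by (simp add: power2_eq_square mult.left_commute)
  then show ?thesis using \<open>x \<noteq> 0\<close> by simp
qed

lemma positive_definite_bounds:
  fixes Q :: "real^'n^'n"
  assumes "positive_definite Q"
  obtains m k where "0 < m" "m \<le> k" "\<And>x. m * (norm x)\<^sup>2 \<le> quad_form Q x"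
    "\<And>x. quad_form Q x \<le> k * (norm x)\<^sup>2"
proof -
  let ?S = "sphere (0::real^'n) 1"
  have cont: "continuous_on ?S (quad_form Q)" by (intro continuous_intros)
  have ne: "?S \<noteq> {}" by simp
  obtain a where a: "a \<in> ?S" "\<And>y. y \<in> ?S \<Longrightarrow> quad_form Q a \<le> quad_form Q y"
    using continuous_attains_inf[OF compact_sphere ne cont] by blast
  obtain b where b: "b \<in> ?S" "\<And>y. y \<in> ?S \<Longrightarrow> quad_form Q y \<le> quad_form Q b"
    using continuous_attains_sup[OF compact_sphere ne cont] by blast
  have scale: "quad_form Q x = (norm x)\<^sup>2 * quad_form Q (x /\<^sub>R norm x)" if "x \<noteq> 0" for x
    using that by (simp add: quad_form_scaleR_vec power_inverse)
  have mem: "x /\<^sub>R norm x \<in> ?S" if "x \<noteq> 0" for x :: "real^'n"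
    using that by simp
  have "a \<noteq> 0" using a(1) by auto
  then have "0 < quad_form Q a" using assms by (simp add: positive_definite_def)
  moreover have "quad_form Q a \<le> quad_form Q b" using a b by blast
  moreover have "quad_form Q a * (norm x)\<^sup>2 \<le> quad_form Q x" for x
  proof (cases "x = 0")
    case False
    show ?thesis unfolding scale[OF False] using mult_left_mono[OF a(2)[OF mem[OF False]], of "(norm x)\<^sup>2"]
      by (simp add: mult.commute)
  qed (simp add: quad_form_def)
  moreover have "quad_form Q x \<le> quad_form Q b * (norm x)\<^sup>2" for x
  proof (cases "x = 0")
    case False
    show ?thesis unfolding scale[OF False] using mult_left_mono[OF b(2)[OF mem[OF False]], of "(norm x)\<^sup>2"]
      by (simp add: mult.commute)
  qed (simp add: quad_form_def)
  ultimately show ?thesis by (rule that)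
qed

text \<open>With \<open>Q = k(1 - A)\<close> and \<open>\<parallel>A\<parallel> \<le> q < 1\<close>, the contraction \<open>Y \<mapsto> (A + Y\<^sup>2) / 2\<close> of the
  \<open>q\<close>-ball has a fixed point \<open>Y\<close>, and \<open>(1 - Y)\<^sup>2 = 1 - A\<close>.\<close>

lemma positive_definite_sqrt_exists:
  fixes Q :: "real^'n^'n"
  assumes pd: "positive_definite Q"
  shows "\<exists>S. positive_definite S \<and> S ** S = Q"
proof -
  obtain m k where mk: "0 < m" "m \<le> k" "\<And>x. m * (norm x)\<^sup>2 \<le> quad_form Q x"
    "\<And>x. quad_form Q x \<le> k * (norm x)\<^sup>2"
    using positive_definite_bounds[OF pd] by blast
  have k: "0 < k" using mk by linarith
  \<comment> \<open>Dividing Q by k puts its form between m/k and 1 on unit vectors, so the form of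
    \<open>A\<close> lies between 0 and q there; q is also the contraction constant.\<close>
  define q where "q = 1 - m / k"
  have q: "0 \<le> q" "q < 1" using mk k by (auto simp: q_def)
  define A where "A = mat 1 - (1 / k) *\<^sub>R Q"
  have symA: "transpose A = A"
    using pd by (simp add: A_def positive_definite_def transpose_def mat_def vec_eq_iff)
  have qfA: "quad_form A x = (norm x)\<^sup>2 - quad_form Q x / k" for x
    by (simp add: A_def quad_form_diff quad_form_scaleR quad_form_mat_1)
  have "\<bar>quad_form A x\<bar> \<le> q * (norm x)\<^sup>2" for x
  proof -
    have "quad_form Q x / k \<le> (norm x)\<^sup>2" using mk(4)[of x] k by (simp add: field_simps)
    moreover have "m / k * (norm x)\<^sup>2 \<le> quad_form Q x / k"
      using mk(3)[of x] k by (simp add: field_simps)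
    ultimately show ?thesis by (simp add: qfA q_def algebra_simps)
  qed
  then have normA: "norm (A *v x) \<le> q * norm x" for x
    by (rule symmetric_matrix_norm_bound[OF symA])
  \<comment> \<open>The bound q concerns the operator norm, whereas the norm of the matrix type is
    the Euclidean norm of the entries; hence the passage to bounded linear maps.\<close>
  define A' where "A' = Blinfun ((*v) A)"
  have A'[simp]: "blinfun_apply A' x = A *v x" for x
    unfolding A'_def by (subst bounded_linear_Blinfun_apply) (simp_all add: linear_linear)
  have nA': "norm A' \<le> q"
    by (rule norm_blinfun_bound[OF q(1)]) (simp add: normA)
  define F where "F = (\<lambda>Y. (1/2) *\<^sub>R (A' + (Y o\<^sub>L Y)))"
  \<comment> \<open>Self-adjointness is a closed condition preserved by F. Building it into K makes
    the fixed point, and with it \<open>S\<close>, symmetric.\<close>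
  define K where "K = {Y :: (real^'n) \<Rightarrow>\<^sub>L (real^'n). norm Y \<le> q \<and> (\<forall>x y. x \<bullet> blinfun_apply Y y = blinfun_apply Y x \<bullet> y)}"
  have "closed K" unfolding K_def
    by (intro closed_Collect_conj closed_Collect_all closed_Collect_le closed_Collect_eq continuous_intros)
  then have "Topological_Spaces.complete K" by (simp add: complete_eq_closed)
  moreover have "K \<noteq> {}"
    using q by (auto simp: K_def intro!: exI[of _ 0])
  moreover have "F ` K \<subseteq> K"
  proof safe
    fix Y assume Y: "Y \<in> K"
    have "norm (Y o\<^sub>L Y) \<le> norm Y * norm Y" by (rule norm_blinfun_compose)
    also have "\<dots> \<le> q * 1" using Y q by (intro mult_mono) (auto simp: K_def)
    finally have "norm (A' + (Y o\<^sub>L Y)) \<le> q + q"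
      using nA' norm_triangle_ineq[of A' "Y o\<^sub>L Y"] by simp
    then have "norm (F Y) \<le> q" by (simp add: F_def)
    moreover have "x \<bullet> F Y y = F Y x \<bullet> y" for x y
      using Y symmetric_matrix_inner_swap[OF symA, of x y]
      by (simp add: F_def K_def blinfun.bilinear_simps inner_add_left inner_add_right)
    ultimately show "F Y \<in> K" by (simp add: K_def)
  qed
  moreover have "dist (F Y) (F Z) \<le> q * dist Y Z" if "Y \<in> K \<and> Z \<in> K" for Y Z
  proof -
    \<comment> \<open>Y and Z need not commute: YY - ZZ = Y(Y - Z) + (Y - Z)Z. Each term costs a
      factor q, and the half in F absorbs the sum.\<close>
    have "F Y - F Z = (1/2) *\<^sub>R ((Y o\<^sub>L (Y - Z)) + ((Y - Z) o\<^sub>L Z))"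
      by (rule blinfun_eqI) (simp add: F_def blinfun.bilinear_simps algebra_simps)
    then have "2 * norm (F Y - F Z) = norm ((Y o\<^sub>L (Y - Z)) + ((Y - Z) o\<^sub>L Z))"
      by simp
    also have "\<dots> \<le> norm Y * norm (Y - Z) + norm (Y - Z) * norm Z"
      using norm_blinfun_compose[of Y "Y - Z"] norm_blinfun_compose[of "Y - Z" Z]
        norm_triangle_ineq[of "Y o\<^sub>L (Y - Z)" "(Y - Z) o\<^sub>L Z"] by linarith
    also have "\<dots> \<le> q * norm (Y - Z) + norm (Y - Z) * q"
      using that by (intro add_mono mult_right_mono mult_left_mono) (auto simp: K_def)
    finally show ?thesis by (simp add: dist_norm)
  qed
  ultimately have "\<exists>!Y\<in>K. F Y = Y"
    using q by (intro Banach_fix[where c=q]) auto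
  then obtain Y where Y: "Y \<in> K" "F Y = Y" by blast
  define M where "M = matrix (blinfun_apply Y)"
  have M[simp]: "M *v x = Y x" for x
    unfolding M_def by (simp add: bounded_linear.linear blinfun.bounded_linear_right)
  have fix_eq: "2 *\<^sub>R Y x = A *v x + Y (Y x)" for x
  proof -
    have "Y x = (1/2) *\<^sub>R (A *v x + Y (Y x))"
      using arg_cong[OF Y(2), of "\<lambda>Z. blinfun_apply Z x"] by (simp add: F_def blinfun.bilinear_simps)
    then show ?thesis by (metis scaleR_half_double scaleR_scaleR scaleR_2 scaleR_right_distrib)
  qed
  define S where "S = sqrt k *\<^sub>R (mat 1 - M)"
  have Sv: "S *v x = sqrt k *\<^sub>R (x - Y x)" for x
    by (simp add: S_def scaleR_matrix_vector matrix_vector_mult_diff_rdistrib)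
  have "S ** S = Q"
  proof (rule matrix_eq[THEN iffD2], rule allI)
    fix x
    have "(S ** S) *v x = k *\<^sub>R (x - 2 *\<^sub>R Y x + Y (Y x))"
      using k by (simp add: matrix_vector_mul_assoc[symmetric] Sv blinfun.bilinear_simps
          algebra_simps scaleR_2)
    also have "\<dots> = k *\<^sub>R (x - A *v x)" by (simp add: fix_eq)
    also have "\<dots> = Q *v x"
      using k by (simp add: A_def matrix_vector_mult_diff_rdistrib scaleR_matrix_vector)
    finally show "(S ** S) *v x = Q *v x" .
  qed
  moreover have "transpose S = S"
    using Y(1) by (simp add: symmetric_matrix_iff_inner Sv inner_diff_left inner_diff_right K_def)
  \<comment> \<open>The fixed point has operator norm at most q < 1, so its form stays strictly
    below that of the identity.\<close>
  moreover have "quad_form S x > 0" if "x \<noteq> 0" for x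
  proof -
    have "x \<bullet> Y x \<le> norm x * norm (Y x)" by (rule norm_cauchy_schwarz)
    also have "\<dots> \<le> norm x * (q * norm x)"
    proof (rule mult_left_mono)
      show "norm (Y x) \<le> q * norm x"
        by (rule order_trans[OF norm_blinfun]) (use Y(1) in \<open>simp add: K_def mult_right_mono\<close>)
    qed simp
    also have "\<dots> = q * (x \<bullet> x)" by (simp add: dot_square_norm power2_eq_square)
    also have "\<dots> < x \<bullet> x" using q that by simp
    finally show ?thesis using k by (simp add: quad_form_def Sv inner_diff_right)
  qed
  ultimately show ?thesis by (auto simp: positive_definite_def)
qed

text \<open>For \<open>D = S - T\<close> and \<open>P = S + T\<close> one has \<open>PD + DP = 0\<close>, so \<open>P[De] = -(De)\<bullet>DPe\<close> for every
  \<open>e\<close>; summing over a basis, \<open>tr (DPD) = - tr (DPD)\<close>.\<close>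

lemma positive_definite_sqrt_unique:
  fixes S T :: "real^'n^'n"
  assumes S: "positive_definite S" and T: "positive_definite T" and eq: "S ** S = T ** T"
  shows "S = T"
proof -
  define D where "D = S - T"
  define P where "P = S + T"
  have symD: "transpose D = D"
    using S T by (simp add: D_def positive_definite_def transpose_def vec_eq_iff)
  have mdl: "(X - Y) ** Z = X ** Z - Y ** Z" and mdr: "Z ** (X - Y) = Z ** X - Z ** Y"
    and mal: "(X + Y) ** Z = X ** Z + Y ** Z" for X Y Z :: "real^'n^'n"
    by (simp_all add: vec_eq_iff matrix_matrix_mult_def sum.distrib sum_subtractf algebra_simps)
  \<comment> \<open>The mixed products cancel, leaving twice S^2 - T^2, which is zero by
    assumption.\<close>
  have PD: "P ** D + D ** P = 0"
    by (simp add: P_def D_def mdl mdr mal matrix_add_ldistrib eq)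
  have "trace (D ** (P ** D)) + trace (D ** (D ** P)) = trace (D ** (P ** D + D ** P))"
    by (simp add: matrix_add_ldistrib trace_add)
  also have "\<dots> = 0" by (simp add: PD trace_def)
  also have "trace (D ** (D ** P)) = trace (D ** (P ** D))"
    by (metis matrix_mul_assoc trace_mul_sym)
  finally have tr0: "trace (D ** (P ** D)) = 0" by simp
  have Pnn: "quad_form P x > 0" if "x \<noteq> 0" for x
    using S T that by (simp add: P_def quad_form_add positive_definite_def add_pos_pos)
  have Pnn': "quad_form P x \<ge> 0" for x
    using Pnn[of x] by (cases "x = 0") (auto simp: quad_form_def)
  \<comment> \<open>This makes the vanishing trace a sum of nonnegative values of the definite form
    P, so every column of D must be zero.\<close>
  have comp: "(D ** (P ** D)) $ i $ i = quad_form P (D *v axis i 1)" for i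
  proof -
    have "quad_form P (D *v axis i 1) = axis i 1 \<bullet> ((D ** P ** D) *v axis i 1)"
      by (simp add: quad_form_congruence[OF symD]) (simp add: quad_form_def)
    also have "\<dots> = (D ** P ** D) $ i $ i"
      by (simp add: inner_axis' matrix_vector_mul_component inner_axis)
    finally show ?thesis by (simp add: matrix_mul_assoc)
  qed
  have "(\<Sum>i\<in>UNIV. quad_form P (D *v axis i 1)) = 0"
    using tr0 by (simp add: trace_def comp)
  then have "quad_form P (D *v axis i 1) = 0" for i
    using Pnn' by (subst (asm) sum_nonneg_eq_0_iff) auto
  then have "D *v axis i 1 = 0" for i
    using Pnn by (metis less_irrefl)
  then have "D $ j $ i = 0" for i j
    by (metis matrix_vector_mul_component inner_axis inner_real_def mult.right_neutral zero_index)
  then show ?thesis by (simp add: D_def vec_eq_iff)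
qed

lemma matrix_sqrt:
  assumes "positive_definite Q"
  shows "positive_definite (matrix_sqrt Q)" "matrix_sqrt Q ** matrix_sqrt Q = Q"
proof -
  have "\<exists>!S. positive_definite S \<and> S ** S = Q"
    using positive_definite_sqrt_exists[OF assms] positive_definite_sqrt_unique by metis
  from theI'[OF this]
  show "positive_definite (matrix_sqrt Q)" "matrix_sqrt Q ** matrix_sqrt Q = Q"
    unfolding matrix_sqrt_def by auto
qed

lemma positive_definite_inverse:
  fixes S :: "real^'n^'n"
  assumes "positive_definite S"
  shows "S ** matrix_inv S = mat 1" "matrix_inv S ** S = mat 1" "transpose (matrix_inv S) = matrix_inv S"
proof -
  have "x = 0" if "S *v x = 0" for x
    using assms that by (auto simp: positive_definite_def quad_form_def)
  then have "invertible S"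
    by (simp add: invertible_left_inverse matrix_left_invertible_ker)
  then have inv: "S ** matrix_inv S = mat 1 \<and> matrix_inv S ** S = mat 1"
    unfolding invertible_def matrix_inv_def by (rule someI_ex)
  then show *: "S ** matrix_inv S = mat 1" "matrix_inv S ** S = mat 1" by auto
  \<comment> \<open>The transposed inverse is again a left inverse of the symmetric S; left and
    right inverses agree.\<close>
  have "transpose (matrix_inv S) ** S = mat 1"
    using arg_cong[OF *(1), of transpose] assms
    by (simp add: matrix_transpose_mul positive_definite_def)
  then show "transpose (matrix_inv S) = matrix_inv S"
    by (metis *(1) matrix_mul_assoc matrix_mul_lid matrix_mul_rid)
qed

section \<open>Polynomial functions\<close>

lemma poly_fun_deg_le_const: "poly_fun_deg_le t (\<lambda>x::real^'n. a)"
  unfolding poly_fun_deg_le_def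
proof (intro exI allI)
  fix x :: "real^'n"
  let ?K = "{k::'n \<Rightarrow> nat. (\<Sum>i\<in>UNIV. k i) \<le> t}"
  have "(\<Sum>k\<in>?K. (if k = (\<lambda>_. 0) then a else 0) * (\<Prod>i\<in>UNIV. (x $ i) ^ k i))
      = (\<Sum>k\<in>?K. if k = (\<lambda>_. 0) then a else 0)"
    by (intro sum.cong) auto
  also have "\<dots> = a"
    using finite_exponents[where 'n='n] by (subst sum.delta) auto
  finally show "a = (\<Sum>k\<in>?K. (if k = (\<lambda>_. 0) then a else 0) * (\<Prod>i\<in>UNIV. (x $ i) ^ k i))" ..
qed

lemma poly_fun_deg_le_add:
  assumes "poly_fun_deg_le t p" "poly_fun_deg_le t q"
  shows "poly_fun_deg_le t (\<lambda>x. p x + q x)"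
proof -
  obtain a b where "\<forall>x. p x = (\<Sum>k\<in>{k. (\<Sum>i\<in>UNIV. k i) \<le> t}. a k * (\<Prod>i\<in>UNIV. (x $ i) ^ k i))"
    "\<forall>x. q x = (\<Sum>k\<in>{k. (\<Sum>i\<in>UNIV. k i) \<le> t}. b k * (\<Prod>i\<in>UNIV. (x $ i) ^ k i))"
    using assms unfolding poly_fun_deg_le_def by blast
  then show ?thesis
    unfolding poly_fun_deg_le_def
    by (intro exI[of _ "\<lambda>k. a k + b k"]) (simp add: sum.distrib distrib_right)
qed

lemma poly_fun_deg_le_cmult:
  assumes "poly_fun_deg_le t p"
  shows "poly_fun_deg_le t (\<lambda>x. c * p x)"
proof -
  obtain a where "\<forall>x. p x = (\<Sum>k\<in>{k. (\<Sum>i\<in>UNIV. k i) \<le> t}. a k * (\<Prod>i\<in>UNIV. (x $ i) ^ k i))"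
    using assms unfolding poly_fun_deg_le_def by blast
  then show ?thesis
    unfolding poly_fun_deg_le_def
    by (intro exI[of _ "\<lambda>k. c * a k"]) (simp add: sum_distrib_left mult.assoc)
qed

lemma poly_fun_deg_le_sum:
  assumes "finite I" "\<And>i. i \<in> I \<Longrightarrow> poly_fun_deg_le t (p i)"
  shows "poly_fun_deg_le t (\<lambda>x. \<Sum>i\<in>I. p i x)"
  using assms by (induction I) (simp_all add: poly_fun_deg_le_const poly_fun_deg_le_add)

lemma poly_fun_deg_le_mono:
  assumes "poly_fun_deg_le s p" "s \<le> t"
  shows "poly_fun_deg_le t p"
proof -
  let ?K = "\<lambda>t. {k. (\<Sum>i\<in>UNIV. k i) \<le> t}"
  obtain a where a: "\<forall>x. p x = (\<Sum>k\<in>?K s. a k * (\<Prod>i\<in>UNIV. (x $ i) ^ k i))"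
    using assms(1) unfolding poly_fun_deg_le_def by blast
  have "(\<Sum>k\<in>?K s. a k * (\<Prod>i\<in>UNIV. (x $ i) ^ k i))
    = (\<Sum>k\<in>?K t. (if k \<in> ?K s then a k else 0) * (\<Prod>i\<in>UNIV. (x $ i) ^ k i))" for x
    using assms(2) by (intro sum.mono_neutral_cong_left finite_exponents) auto
  with a show ?thesis
    unfolding poly_fun_deg_le_def by (intro exI[of _ "\<lambda>k. if k \<in> ?K s then a k else 0"]) simp
qed

text \<open>Raising the exponent of j by one is a bijection from the exponent vectors of degree at
  most t onto those of degree at most t + 1 with nonzero entry at j.\<close>

lemma poly_fun_deg_le_times_coord:
  fixes p :: "real^'n \<Rightarrow> real"
  assumes "poly_fun_deg_le t p"
  shows "poly_fun_deg_le (Suc t) (\<lambda>x. x $ j * p x)"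
proof -
  let ?K = "\<lambda>t. {k::'n \<Rightarrow> nat. (\<Sum>i\<in>UNIV. k i) \<le> t}"
  let ?m = "\<lambda>k x. \<Prod>i\<in>UNIV. (x $ i) ^ k i"
  obtain a where a: "\<And>x. p x = (\<Sum>k\<in>?K t. a k * ?m k x)"
    using assms(1) unfolding poly_fun_deg_le_def by blast
  have sum_split: "(\<Sum>i\<in>UNIV. k i) = k j + (\<Sum>i\<in>UNIV - {j}. k i)" for k :: "'n \<Rightarrow> nat"
    by (rule sum.remove) auto
  \<comment> \<open>Vectors without a factor x_j get coefficient 0; the case distinction also keeps
    the truncated subtraction from reading a wrong coefficient.\<close>
  define b where "b k = (if k j = 0 then 0 else a (k(j := k j - 1)))" for k
  have "x $ j * p x = (\<Sum>k\<in>?K (Suc t). b k * ?m k x)" for x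
  proof -
    have "(\<Sum>k\<in>?K (Suc t). b k * ?m k x) = (\<Sum>k\<in>{k\<in>?K (Suc t). k j \<noteq> 0}. b k * ?m k x)"
      by (rule sum.mono_neutral_right[OF finite_exponents]) (auto simp: b_def)
    also have "\<dots> = (\<Sum>k\<in>?K t. x $ j * (a k * ?m k x))"
    proof (rule sum.reindex_bij_witness[where i = "\<lambda>k. k(j := Suc (k j))" and j = "\<lambda>k. k(j := k j - 1)"])
      fix k assume k: "k \<in> {k \<in> ?K (Suc t). k j \<noteq> 0}"
      have "?m k x = x $ j * ?m (k(j := k j - 1)) x"
        using k power_minus_mult[of "k j" "x $ j"]
        by (simp add: prod.remove[of UNIV j] mult.commute[of "x $ j"] mult.assoc[symmetric] mult.left_commute)
      then show "x $ j * (a (k(j := k j - 1)) * ?m (k(j := k j - 1)) x) = b k * ?m k x"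
        using k by (simp add: b_def)
    qed (auto simp: sum_split)
    also have "\<dots> = x $ j * p x" by (simp add: a sum_distrib_left)
    finally show ?thesis ..
  qed
  then show ?thesis unfolding poly_fun_deg_le_def by blast
qed

lemma poly_fun_deg_le_times_affine:
  fixes p :: "real^'n \<Rightarrow> real"
  assumes "poly_fun_deg_le t p"
  shows "poly_fun_deg_le (Suc t) (\<lambda>x. (a + b \<bullet> x) * p x)"
proof -
  have "poly_fun_deg_le (Suc t) (\<lambda>x. a * p x + (\<Sum>j\<in>UNIV. b $ j * (x $ j * p x)))"
    by (intro poly_fun_deg_le_add poly_fun_deg_le_sum poly_fun_deg_le_cmult poly_fun_deg_le_times_coord
        poly_fun_deg_le_mono[OF assms] assms) auto
  then show ?thesis
    by (simp add: inner_vec_def distrib_right sum_distrib_right mult.assoc)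
qed

lemma eval_quadratic_coords:
  "eval_quadratic q y = const_part q
    + (\<Sum>i\<in>UNIV. 2 * lin_part q $ i * y $ i)
    + (\<Sum>i\<in>UNIV. \<Sum>j\<in>UNIV. quad_part q $ i $ j * (y $ i * y $ j))"
  by (simp add: eval_quadratic_def quad_form_def inner_vec_def matrix_vector_mult_def
      sum_distrib_left mult_ac)

text \<open>Every term of q after an affine substitution has at most two affine factors, multiplied
  on one at a time. Taking p = 1 gives degree 2; taking the composed quadratic itself as p gives
  degree 4 for its square.\<close>

lemma poly_fun_deg_le_quadratic_times:
  fixes p :: "real^'n \<Rightarrow> real" and q :: "'n quadratic"
  assumes p: "poly_fun_deg_le t p" and L: "\<And>x i. L x $ i = a i + b i \<bullet> x"
  shows "poly_fun_deg_le (t + 2) (\<lambda>x. eval_quadratic q (L x) * p x)"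
proof -
  have "poly_fun_deg_le (t + 2) (\<lambda>x. const_part q * p x
      + (\<Sum>i\<in>UNIV. 2 * lin_part q $ i * ((a i + b i \<bullet> x) * p x))
      + (\<Sum>i\<in>UNIV. \<Sum>j\<in>UNIV. quad_part q $ i $ j * ((a i + b i \<bullet> x) * ((a j + b j \<bullet> x) * p x))))"
    by (intro poly_fun_deg_le_add poly_fun_deg_le_sum poly_fun_deg_le_cmult finite
          poly_fun_deg_le_mono[OF p] poly_fun_deg_le_mono[OF poly_fun_deg_le_times_affine[OF p]])
       (simp_all add: poly_fun_deg_le_times_affine p)
  then show ?thesis
    by (simp add: eval_quadratic_coords L distrib_right sum_distrib_right mult.assoc)
qed

section \<open>Integration over the unit sphere\<close>

lemma sets_unit_sphere_measure [measurable_cong, simp]: "sets unit_sphere_measure = sets borel"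
  by (simp add: unit_sphere_measure_def)

lemma space_unit_sphere_measure [simp]: "space unit_sphere_measure = UNIV"
  by (simp add: unit_sphere_measure_def)

lemma AE_unit_sphere_measure: "AE y in unit_sphere_measure. norm (y::real^'n) = 1"
proof -
  interpret prob_space "unit_sphere_measure :: (real^'n) measure"
    by (rule prob_space_unit_sphere_measure)
  have "prob (sphere 0 1) = 1"
    by (simp add: measure_def unit_sphere_measure_sphere)
  from AE_prob_1[OF this] show ?thesis by eventually_elim simp
qed

text \<open>Almost every point lies on the sphere, where compactness bounds a continuous
  function.\<close>

lemma integrable_unit_sphere_measure:
  fixes h :: "real^'n \<Rightarrow> real"
  assumes "continuous_on UNIV h"
  shows "integrable unit_sphere_measure h"
proof -
  interpret prob_space "unit_sphere_measure :: (real^'n) measure"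
    by (rule prob_space_unit_sphere_measure)
  have "compact (h ` sphere 0 1)"
    by (intro compact_continuous_image continuous_on_subset[OF assms]) auto
  then have "bounded (h ` sphere 0 1)" by (rule compact_imp_bounded)
  then obtain B where "\<And>y. norm y = 1 \<Longrightarrow> norm (h y) \<le> B"
    unfolding bounded_iff by (metis dist_0_norm imageI mem_sphere)
  then have "AE y in unit_sphere_measure. norm (h y) \<le> B"
    using AE_unit_sphere_measure by auto
  moreover have "h \<in> borel_measurable unit_sphere_measure"
    using borel_measurable_continuous_onI[OF assms] by (simp cong: measurable_cong_sets)
  ultimately show ?thesis by (rule integrable_const_bound)
qed

lemma integral_unit_sphere_measure_orthogonal:
  fixes h :: "real^'n \<Rightarrow> real" and g :: "real^'n \<Rightarrow> real^'n"
  assumes g: "orthogonal_transformation g" and h: "h \<in> borel_measurable borel"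
  shows "(\<integral>y. h (g y) \<partial>unit_sphere_measure) = (\<integral>y. h y \<partial>unit_sphere_measure)"
proof -
  have "g \<in> borel_measurable borel"
    using orthogonal_transformation_linear[OF g]
    by (intro borel_measurable_continuous_onI linear_continuous_on) (simp add: linear_conv_bounded_linear)
  then have "(\<integral>y. h y \<partial>distr unit_sphere_measure borel g) = (\<integral>y. h (g y) \<partial>unit_sphere_measure)"
    using h by (intro integral_distr) (simp_all cong: measurable_cong_sets)
  then show ?thesis by (simp add: unit_sphere_measure_invariant[OF g])
qed

lemma integral_unit_sphere_measure_coord:
  "(\<integral>(y::real^'n). y $ i \<partial>unit_sphere_measure) = 0"
proof -
  have "(\<integral>(y::real^'n). (- y) $ i \<partial>unit_sphere_measure) = (\<integral>(y::real^'n). y $ i \<partial>unit_sphere_measure)"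
    by (rule integral_unit_sphere_measure_orthogonal)
      (auto simp: orthogonal_transformation_neg orthogonal_transformation_id[unfolded id_def])
  then show ?thesis by simp
qed

lemma orthogonal_transformation_flip_coord:
  "orthogonal_transformation (\<lambda>y::real^'n. \<chi> k. if k = i then - y $ k else y $ k)"
  unfolding orthogonal_transformation_def
proof
  show "linear (\<lambda>y::real^'n. \<chi> k. if k = i then - y $ k else y $ k)"
    by (rule linearI) (simp_all add: vec_eq_iff)
qed (auto simp: inner_vec_def intro!: sum.cong)

lemma orthogonal_transformation_swap_coords:
  "orthogonal_transformation (\<lambda>y::real^'n. \<chi> k. y $ Transposition.transpose i j k)"
  unfolding orthogonal_transformation_def
proof
  show "linear (\<lambda>y::real^'n. \<chi> k. y $ Transposition.transpose i j k)"
    by (rule linearI) (simp_all add: vec_eq_iff)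
qed (auto simp: inner_vec_def intro!: sum.reindex_bij_witness[of _ "Transposition.transpose i j" "Transposition.transpose i j"])

text \<open>Flipping the sign of one coordinate negates the mixed moment, which is therefore 0.
  Swapping coordinates makes all pure second moments equal, and their sum is the integral of |y|^2,
  which is 1.\<close>

lemma integral_unit_sphere_measure_coord_mult:
  "(\<integral>(y::real^'n). y $ i * y $ j \<partial>unit_sphere_measure) = (if i = j then 1 / CARD('n) else 0)"
proof (cases "i = j")
  case False
  have "(\<integral>(y::real^'n). (\<chi> k. if k = i then - y $ k else y $ k) $ i * (\<chi> k. if k = i then - y $ k else y $ k) $ j
      \<partial>unit_sphere_measure) = (\<integral>(y::real^'n). y $ i * y $ j \<partial>unit_sphere_measure)"
    by (rule integral_unit_sphere_measure_orthogonal[OF orthogonal_transformation_flip_coord,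
        of "\<lambda>y. y $ i * y $ j"]) simp
  then show ?thesis using False by simp
next
  case True
  interpret prob_space "unit_sphere_measure :: (real^'n) measure"
    by (rule prob_space_unit_sphere_measure)
  have eq: "(\<integral>(y::real^'n). y $ k * y $ k \<partial>unit_sphere_measure) = (\<integral>(y::real^'n). y $ i * y $ i \<partial>unit_sphere_measure)" for k
    using integral_unit_sphere_measure_orthogonal[OF orthogonal_transformation_swap_coords[of i k],
        of "\<lambda>y. y $ i * y $ i"] by simp
  have "real CARD('n) * (\<integral>(y::real^'n). y $ i * y $ i \<partial>unit_sphere_measure)
      = (\<Sum>k\<in>(UNIV::'n set). (\<integral>(y::real^'n). y $ i * y $ i \<partial>unit_sphere_measure))"
    by simp
  also have "\<dots> = (\<Sum>k\<in>UNIV. (\<integral>(y::real^'n). y $ k * y $ k \<partial>unit_sphere_measure))"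
    by (rule sum.cong[OF refl eq[symmetric]])
  also have "\<dots> = (\<integral>(y::real^'n). (\<Sum>k\<in>UNIV. y $ k * y $ k) \<partial>unit_sphere_measure)"
    by (rule Bochner_Integration.integral_sum[symmetric])
      (rule integrable_unit_sphere_measure, intro continuous_intros)
  also have "\<dots> = (\<integral>(y::real^'n). 1 \<partial>unit_sphere_measure)"
  proof (rule integral_cong_AE)
    show "AE y in unit_sphere_measure. (\<Sum>k\<in>UNIV. y $ k * y $ k) = 1"
      using AE_unit_sphere_measure
    proof eventually_elim
      case (elim y)
      then have "y \<bullet> y = 1" by (simp only: norm_eq_1)
      then show ?case by (simp only: inner_vec_def inner_real_def)
    qed
  qed (rule borel_measurable_integrable, rule integrable_unit_sphere_measure, intro continuous_intros)+
  also have "\<dots> = 1" using prob_space by simp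
  finally show ?thesis using True by (simp add: field_simps)
qed

lemma continuous_eval_quadratic [continuous_intros]:
  "continuous_on A f \<Longrightarrow> continuous_on A (\<lambda>x. eval_quadratic q (f x))"
  unfolding eval_quadratic_def by (intro continuous_intros)

lemma integral_unit_sphere_measure_quadratic:
  fixes q :: "'n::finite quadratic"
  shows "(\<integral>y. eval_quadratic q y \<partial>unit_sphere_measure)
    = const_part q + trace (quad_part q) / CARD('n)"
proof -
  interpret prob_space "unit_sphere_measure :: (real^'n) measure"
    by (rule prob_space_unit_sphere_measure)
  have i0: "integrable unit_sphere_measure h" if "continuous_on UNIV h" for h :: "real^'n \<Rightarrow> real"
    by (rule integrable_unit_sphere_measure[OF that])
  have "(\<integral>y. eval_quadratic q y \<partial>unit_sphere_measure) =
      (\<integral>(y::real^'n). const_part q \<partial>unit_sphere_measure)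
    + (\<integral>y. (\<Sum>i\<in>UNIV. 2 * lin_part q $ i * y $ i) \<partial>unit_sphere_measure)
    + (\<integral>y. (\<Sum>i\<in>UNIV. \<Sum>j\<in>UNIV. quad_part q $ i $ j * (y $ i * y $ j)) \<partial>unit_sphere_measure)"
    unfolding eval_quadratic_coords
    by (subst Bochner_Integration.integral_add; (intro i0 continuous_intros)?)+ simp
  also have "(\<integral>y. (\<Sum>i\<in>UNIV. 2 * lin_part q $ i * y $ i) \<partial>unit_sphere_measure)
    = (\<Sum>i\<in>UNIV. \<integral>y. 2 * lin_part q $ i * y $ i \<partial>unit_sphere_measure)"
    by (rule Bochner_Integration.integral_sum) (intro i0 continuous_intros)
  also have "(\<integral>y. (\<Sum>i\<in>UNIV. \<Sum>j\<in>UNIV. quad_part q $ i $ j * (y $ i * y $ j)) \<partial>unit_sphere_measure)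
    = (\<Sum>i\<in>UNIV. \<integral>y. (\<Sum>j\<in>UNIV. quad_part q $ i $ j * (y $ i * y $ j)) \<partial>unit_sphere_measure)"
    by (rule Bochner_Integration.integral_sum) (intro i0 continuous_intros)
  also have "\<dots> = (\<Sum>i\<in>UNIV. \<Sum>j\<in>UNIV. \<integral>y. quad_part q $ i $ j * (y $ i * y $ j) \<partial>unit_sphere_measure)"
    by (intro sum.cong refl Bochner_Integration.integral_sum i0 continuous_intros)
  finally have "(\<integral>y. eval_quadratic q y \<partial>unit_sphere_measure) = const_part q
     + (\<Sum>i\<in>UNIV. \<Sum>j\<in>UNIV. quad_part q $ i $ j * (if i = j then 1 / CARD('n) else 0))"
    using prob_space
    by (simp add: integral_unit_sphere_measure_coord integral_unit_sphere_measure_coord_mult)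
  then show ?thesis
    by (simp add: trace_def sum_divide_distrib if_distrib cong: if_cong)
qed

text \<open>If h were nonzero at y, the points of the ball projecting radially into the nonzero set
  of h would form a nonempty open set; the vanishing integral makes this set null, a
  contradiction.\<close>

lemma unit_sphere_measure_full_support:
  fixes h :: "real^'n \<Rightarrow> real"
  assumes cont: "continuous_on UNIV h" and nonneg: "\<And>y. 0 \<le> h y"
    and zero: "(\<integral>y. h y \<partial>unit_sphere_measure) = 0" and y: "norm y = 1"
  shows "h y = 0"
proof (rule ccontr)
  assume hy: "h y \<noteq> 0"
  let ?p = "\<lambda>x::real^'n. x /\<^sub>R norm x"
  \<comment> \<open>The origin is left out because the radial projection is not continuous
    there.\<close>
  define U where "U = {x \<in> ball 0 1 - {0}. h (?p x) \<noteq> 0}"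
  have hm: "h \<in> borel_measurable borel" by (rule borel_measurable_continuous_onI[OF cont])
  have "AE y in unit_sphere_measure. h y = 0"
    using zero nonneg by (subst (asm) integral_nonneg_eq_0_iff_AE)
      (auto intro: integrable_unit_sphere_measure[OF cont])
  then have "AE x in uniform_measure lborel (ball 0 1). h (?p x) = 0"
    unfolding unit_sphere_measure_def using hm by (subst (asm) AE_distr_iff) auto
  then have "AE x in lborel. x \<in> ball 0 1 \<longrightarrow> h (?p x) = 0"
    by (subst (asm) AE_uniform_measure) (use unit_ball_emeasure[where 'a="real^'n"] in \<open>auto simp: top.not_eq_extremum\<close>)
  then have "AE x in lborel. \<not> (x \<in> U)"
    by eventually_elim (auto simp: U_def)
  then have "emeasure lborel {x \<in> space lborel. x \<in> U} = 0"
    by (rule emeasure_eq_0_AE)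
  moreover have "open U"
  proof -
    have "continuous_on (ball 0 1 - {0}) (\<lambda>x. h (?p x))"
      by (intro continuous_on_compose2[OF cont] continuous_intros) auto
    then have "open ((ball 0 1 - {0}) \<inter> (\<lambda>x. h (?p x)) -` (- {0}))"
      by (intro continuous_open_preimage) auto
    also have "(ball 0 1 - {0}) \<inter> (\<lambda>x. h (?p x)) -` (- {0}) = U" by (auto simp: U_def)
    finally show ?thesis .
  qed
  ultimately have "negligible U"
    by (simp add: negligible_iff_emeasure0)
  moreover have "(1/2) *\<^sub>R y \<in> U" using y hy by (auto simp: U_def)
  ultimately show False using open_not_negligible[OF \<open>open U\<close>] by blast
qed

section \<open>Second-order bound for the determinant\<close>

text \<open>C depends on the index set alone. In the induction the new remainder is (1 + a_j) times
  the old one plus the cross term of a_j with the sum of the other a_i.\<close>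

lemma prod_one_plus_second_order:
  assumes "finite A"
  shows "\<exists>C\<ge>0. \<forall>a m. (\<forall>i\<in>A. \<bar>a i\<bar> \<le> m) \<longrightarrow> 0 \<le> m \<longrightarrow> m \<le> 1 \<longrightarrow>
    \<bar>(\<Prod>i\<in>A. 1 + a i) - 1 - (\<Sum>i\<in>A. a i)\<bar> \<le> C * (m::real)\<^sup>2"
  using assms
proof (induction A)
  case empty
  then show ?case by (intro exI[of _ 0]) simp
next
  case (insert j A)
  then obtain C where C: "C \<ge> 0" "\<And>a m. (\<forall>i\<in>A. \<bar>a i\<bar> \<le> m) \<Longrightarrow> 0 \<le> m \<Longrightarrow> m \<le> 1 \<Longrightarrow>
    \<bar>(\<Prod>i\<in>A. 1 + a i) - 1 - (\<Sum>i\<in>A. a i)\<bar> \<le> C * (m::real)\<^sup>2" by blast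
  show ?case
  \<comment> \<open>The factor 2 bounds |1 + a_j|, and \<open>card A\<close> bounds the cross term
    divided by m^2.\<close>
  proof (intro exI[of _ "2 * C + card A"] conjI allI impI)
    fix a m assume am: "\<forall>i\<in>insert j A. \<bar>a i\<bar> \<le> m" and m: "0 \<le> m" "m \<le> (1::real)"
    let ?R = "(\<Prod>i\<in>A. 1 + a i) - 1 - (\<Sum>i\<in>A. a i)"
    have R: "\<bar>?R\<bar> \<le> C * m\<^sup>2" using C(2)[of a m] am m by simp
    have "\<bar>\<Sum>i\<in>A. a i\<bar> \<le> (\<Sum>i\<in>A. \<bar>a i\<bar>)" by (rule sum_abs)
    also have "\<dots> \<le> card A * m" using am by (intro sum_bounded_above) auto
    finally have S: "\<bar>\<Sum>i\<in>A. a i\<bar> \<le> card A * m" .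
    have "\<bar>(1 + a j) * ?R + a j * (\<Sum>i\<in>A. a i)\<bar> \<le> \<bar>1 + a j\<bar> * \<bar>?R\<bar> + \<bar>a j\<bar> * \<bar>\<Sum>i\<in>A. a i\<bar>"
      by (metis abs_mult abs_triangle_ineq)
    also have "\<dots> \<le> 2 * (C * m\<^sup>2) + m * (card A * m)"
      using am m R S by (intro add_mono mult_mono) auto
    finally show "\<bar>(\<Prod>i\<in>insert j A. 1 + a i) - 1 - (\<Sum>i\<in>insert j A. a i)\<bar> \<le> (2 * C + card A) * m\<^sup>2"
      using insert by (simp add: algebra_simps power2_eq_square)
  qed (use C in simp)
qed

text \<open>In Leibniz' formula every permutation but the identity contributes at least two
  off-diagonal factors.\<close>

lemma det_one_plus_second_order:
  "\<exists>D\<ge>0. \<forall>N::real^'n^'n. norm N \<le> 1 \<longrightarrow> 1 + trace N - D * (norm N)\<^sup>2 \<le> det (mat 1 + N)"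
proof -
  obtain C where C: "C \<ge> 0" "\<And>a m. (\<forall>i\<in>(UNIV::'n set). \<bar>a i\<bar> \<le> m) \<Longrightarrow> 0 \<le> m \<Longrightarrow> m \<le> 1 \<Longrightarrow>
    \<bar>(\<Prod>i\<in>UNIV. 1 + a i) - 1 - (\<Sum>i\<in>UNIV. a i)\<bar> \<le> C * (m::real)\<^sup>2"
    using prod_one_plus_second_order[of "UNIV::'n set"] by auto
  let ?P = "{p. p permutes (UNIV::'n set)}"
  let ?B = "2 ^ CARD('n) :: real"
  show ?thesis
  \<comment> \<open>C is the error of the diagonal product; each remaining permutation costs at most
    2^n |N|^2.\<close>
  proof (intro exI[of _ "C + card (?P - {id}) * ?B"] conjI allI impI)
    fix N :: "real^'n^'n" assume N: "norm N \<le> 1"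
    let ?m = "norm N"
    have ent: "\<bar>N $ i $ j\<bar> \<le> ?m" for i j
      using component_le_norm_cart[of "N $ i" j] Finite_Cartesian_Product.norm_nth_le[of N i] by linarith
    let ?t = "\<lambda>p. of_int (sign p) * (\<Prod>i\<in>UNIV. (mat 1 + N) $ i $ p i)"
    have "\<bar>(\<Prod>i\<in>UNIV. 1 + N $ i $ i) - 1 - (\<Sum>i\<in>UNIV. N $ i $ i)\<bar> \<le> C * ?m\<^sup>2"
      by (rule C(2)) (use ent N in auto)
    then have idt: "1 + trace N - C * ?m\<^sup>2 \<le> ?t id"
      by (simp add: trace_def sign_id mat_def)
    have other: "\<bar>?t p\<bar> \<le> ?B * ?m\<^sup>2" if p: "p \<in> ?P - {id}" for p
    proof -
      from p obtain i where i: "p i \<noteq> i" by (auto simp: fun_eq_iff)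
      from p have "inj p" by (auto intro: permutes_inj)
      \<comment> \<open>The rows i and p i are distinct and both moved, which supplies two factors
        of size |N|; every other factor is at most 1 + |N| \<le> 2.\<close>
      with i have pi: "p (p i) \<noteq> p i" by (auto dest: injD)
      let ?R = "UNIV - {i} - {p i}"
      let ?e = "\<lambda>k. (mat 1 + N) $ k $ p k"
      have "(\<Prod>k\<in>UNIV. ?e k) = ?e i * (?e (p i) * (\<Prod>k\<in>?R. ?e k))"
        using i by (simp add: prod.remove[of UNIV i] prod.remove[of "UNIV - {i}" "p i"])
      then have "\<bar>?t p\<bar> = \<bar>N $ i $ p i\<bar> * (\<bar>N $ p i $ p (p i)\<bar> * (\<Prod>k\<in>?R. \<bar>?e k\<bar>))"
        using i pi by (simp add: abs_mult abs_prod sign_def mat_def)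
      also have "\<dots> \<le> ?m * (?m * (\<Prod>k\<in>?R. 2))"
      proof (intro mult_mono prod_mono ent conjI)
        fix k
        show "\<bar>?e k\<bar> \<le> 2" using ent[of k "p k"] ent[of k k] N by (auto simp: mat_def)
      qed (auto intro!: mult_nonneg_nonneg prod_nonneg)
      also have "\<dots> \<le> ?m * (?m * ?B)"
        by (intro mult_left_mono) (auto intro!: power_increasing card_mono)
      finally show ?thesis by (simp add: power2_eq_square mult_ac)
    qed
    have "\<bar>\<Sum>p\<in>?P - {id}. ?t p\<bar> \<le> (\<Sum>p\<in>?P - {id}. \<bar>?t p\<bar>)" by (rule sum_abs)
    also have "\<dots> \<le> card (?P - {id}) * (?B * ?m\<^sup>2)"
      by (rule sum_bounded_above[OF other])
    finally have "- (card (?P - {id}) * ?B * ?m\<^sup>2) \<le> (\<Sum>p\<in>?P - {id}. ?t p)"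
      by (simp add: mult.assoc)
    moreover have "det (mat 1 + N) = ?t id + (\<Sum>p\<in>?P - {id}. ?t p)"
      unfolding det_def by (rule sum.remove) (auto simp: permutes_id)
    ultimately show "1 + trace N - (C + card (?P - {id}) * ?B) * ?m\<^sup>2 \<le> det (mat 1 + N)"
      using idt by (simp only: distrib_right)
  qed (use C in simp)
qed

section \<open>Quadratic functions on spherical designs\<close>

lemma eval_quadratic_add: "eval_quadratic (p + q) x = eval_quadratic p x + eval_quadratic q x"
  by (simp add: eval_quadratic_def const_part_def lin_part_def quad_part_def quad_form_add inner_add_left)

lemma eval_quadratic_scaleR: "eval_quadratic (k *\<^sub>R q) x = k * eval_quadratic q x"
  by (simp add: eval_quadratic_def const_part_def lin_part_def quad_part_def quad_form_scaleR algebra_simps)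

lemma linear_eval_quadratic: "linear (\<lambda>q. eval_quadratic q x)"
  by (rule linearI) (simp_all add: eval_quadratic_add eval_quadratic_scaleR)

definition sphere_quadratic :: "'n::finite quadratic" where
  "sphere_quadratic = (- 1, 0, mat 1)"

lemma eval_sphere_quadratic: "eval_quadratic sphere_quadratic y = (norm y)\<^sup>2 - 1"
  by (simp add: sphere_quadratic_def eval_quadratic_def const_part_def lin_part_def quad_part_def quad_form_mat_1)

lemma trace_scaleR: "trace (k *\<^sub>R A) = k * trace (A :: real^'n^'n)"
  by (simp add: trace_def sum_distrib_left)

lemma transpose_congruence:
  fixes P T :: "real^'n^'n"
  assumes "transpose T = T" "transpose P = P"
  shows "transpose (T ** P ** T) = T ** P ** T"
  using assms by (simp add: matrix_transpose_mul matrix_mul_assoc)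

lemma norm_matrix_vector_mult_le: "norm (A *v x) \<le> norm A * norm (x :: real^'n)"
proof -
  have "norm (A *v x) \<le> L2_set (\<lambda>i. norm (A $ i) * norm x) UNIV"
    unfolding norm_vec_def[of "A *v x"]
    by (intro L2_set_mono) (simp_all add: matrix_vector_mul_component Cauchy_Schwarz_ineq2)
  also have "\<dots> = norm A * norm x"
    by (simp add: L2_set_left_distrib norm_vec_def[of A])
  finally show ?thesis .
qed

lemma abs_quad_form_le: "\<bar>quad_form N y\<bar> \<le> norm N * (norm y)\<^sup>2"
proof -
  have "\<bar>quad_form N y\<bar> \<le> norm y * norm (N *v y)"
    unfolding quad_form_def by (rule Cauchy_Schwarz_ineq2)
  also have "\<dots> \<le> norm y * (norm N * norm y)"
    by (intro mult_left_mono norm_matrix_vector_mult_le) simp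
  finally show ?thesis by (simp add: power2_eq_square mult_ac)
qed

lemma det_scaleR: "det (k *\<^sub>R A) = k ^ CARD('n) * det (A :: real^'n^'n)"
  by (simp add: det_def prod.distrib sum_distrib_left mult_ac)

text \<open>Comparing y with -y separates the linear part, which must vanish, from the even part. By
  homogeneity the form of Q + a is then zero on the whole space, and symmetry makes this matrix
  zero.\<close>

lemma quadratic_vanishing_on_sphere:
  fixes q :: "'n::finite quadratic"
  assumes sym: "transpose (quad_part q) = quad_part q"
    and zero: "\<And>y. norm y = 1 \<Longrightarrow> eval_quadratic q y = 0"
  shows "q = (- const_part q) *\<^sub>R sphere_quadratic"
proof -
  let ?a = "const_part q" and ?b = "lin_part q" and ?Q = "quad_part q"
  have 1: "?b \<bullet> y = 0 \<and> quad_form ?Q y = - ?a" if "norm y = 1" for y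
    using zero[OF that] zero[of "- y"] that quad_form_scaleR_vec[of ?Q "-1" y]
    by (simp add: eval_quadratic_def)
  have b: "?b = 0"
  proof (rule ccontr)
    assume "?b \<noteq> 0"
    then show False using 1[of "?b /\<^sub>R norm ?b"] by simp
  qed
  have "?Q + ?a *\<^sub>R mat 1 = 0"
  proof (rule symmetric_matrix_eq_0)
    show "transpose (?Q + ?a *\<^sub>R mat 1) = ?Q + ?a *\<^sub>R mat 1"
      using sym by (simp add: transpose_def mat_def vec_eq_iff)
    show "quad_form (?Q + ?a *\<^sub>R mat 1) x = 0" for x
    proof (cases "x = 0")
      case True
      then show ?thesis by (simp add: quad_form_def)
    next
      case False
      then have "quad_form ?Q (x /\<^sub>R norm x) = - ?a" using 1[of "x /\<^sub>R norm x"] by simp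
      then show ?thesis
        using False by (simp add: quad_form_add quad_form_scaleR quad_form_mat_1 quad_form_scaleR_vec field_simps)
    qed
  qed
  then have "?Q = - (?a *\<^sub>R mat 1)" by (simp add: eq_neg_iff_add_eq_0)
  with b show ?thesis
    by (simp add: sphere_quadratic_def const_part_def lin_part_def quad_part_def prod_eq_iff)
qed

text \<open>On the finite-dimensional space of quadratic functions with trace-free quadratic part the
  values on \<open>Y\<close> determine the function, and nonnegative values average to the constant part.\<close>

lemma norm_quadratic_le_const_part:
  fixes Y :: "(real^'n) set"
  assumes fin: "finite Y"
    and avg: "\<And>q. (\<Sum>y\<in>Y. eval_quadratic q y) = card Y * (const_part q + trace (quad_part q) / CARD('n))"
    and kern: "\<And>q. transpose (quad_part q) = quad_part q \<Longrightarrow> (\<And>y. y \<in> Y \<Longrightarrow> eval_quadratic q y = 0)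
      \<Longrightarrow> \<exists>l. q = l *\<^sub>R sphere_quadratic"
  shows "\<exists>K>0. \<forall>q. transpose (quad_part q) = quad_part q \<longrightarrow> trace (quad_part q) = 0 \<longrightarrow>
    (\<forall>y\<in>Y. 0 \<le> eval_quadratic q y) \<longrightarrow> norm q \<le> K * const_part q"
proof -
  \<comment> \<open>The trace condition excludes the nonzero multiples of
    \<open>sphere_quadratic\<close>, the only functions that \<open>kern\<close> lets vanish on Y.
    So F, defined below, is a norm on W, comparable with the given one by compactness.\<close>
  define W where "W = {q :: 'n quadratic. transpose (quad_part q) = quad_part q \<and> trace (quad_part q) = 0}"
  have scale: "k *\<^sub>R q \<in> W" if "q \<in> W" for k q
    using that by (simp add: W_def quad_part_def transpose_scalar trace_scaleR)
  define F where "F q = (\<Sum>y\<in>Y. \<bar>eval_quadratic q y\<bar>)" for q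
  have Fscale: "F (k *\<^sub>R q) = \<bar>k\<bar> * F q" for k q
    by (simp add: F_def eval_quadratic_scaleR abs_mult sum_distrib_left)
  have cont: "continuous_on A (\<lambda>q::'n quadratic. eval_quadratic q y)" for A y
    by (rule linear_continuous_on) (use linear_eval_quadratic linear_conv_bounded_linear in blast)
  have "closed W"
    unfolding W_def quad_part_def transpose_def trace_def vec_eq_iff vec_lambda_beta
    by (intro closed_Collect_conj closed_Collect_all closed_Collect_eq continuous_intros)
  then have comp: "compact (W \<inter> sphere 0 1)"
    by (intro closed_Int_compact) auto
  have "\<exists>m>0. \<forall>q\<in>W. m * norm q \<le> F q"
  proof (cases "W \<inter> sphere 0 1 = {}")
    case True
    have W0: "q = 0" if "q \<in> W" for q
    proof (rule ccontr)
      assume "q \<noteq> 0"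
      then have "q /\<^sub>R norm q \<in> W \<inter> sphere 0 1" using scale[OF that] by simp
      with True show False by blast
    qed
    then have "norm q \<le> F q" if "q \<in> W" for q using W0[OF that] by (simp add: F_def sum_nonneg)
    then show ?thesis by (intro exI[of _ 1]) simp
  next
    case False
    have "continuous_on (W \<inter> sphere 0 1) F"
      unfolding F_def by (intro continuous_intros cont)
    then obtain q0 where q0: "q0 \<in> W \<inter> sphere 0 1" "\<And>q. q \<in> W \<inter> sphere 0 1 \<Longrightarrow> F q0 \<le> F q"
      using continuous_attains_inf[OF comp False] by blast
    have "F q0 \<noteq> 0"
    proof
      assume "F q0 = 0"
      then have "\<And>y. y \<in> Y \<Longrightarrow> eval_quadratic q0 y = 0"
        using fin by (simp add: F_def sum_nonneg_eq_0_iff)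
      then obtain l where l: "q0 = l *\<^sub>R sphere_quadratic"
        using kern[of q0] q0(1) unfolding W_def by blast
      have "trace (quad_part q0) = 0" using q0(1) by (simp add: W_def)
      then have "l = 0"
        by (simp add: l sphere_quadratic_def quad_part_def trace_scaleR trace_I)
      then show False using l q0(1) by simp
    qed
    moreover have "0 \<le> F q0" by (simp add: F_def sum_nonneg)
    ultimately have "0 < F q0" by simp
    moreover have "F q0 * norm q \<le> F q" if "q \<in> W" for q
    proof (cases "q = 0")
      case False
      then have "F q0 \<le> F (q /\<^sub>R norm q)" using scale[OF that] by (intro q0(2)) simp
      then show ?thesis using False by (simp add: Fscale field_simps)
    qed (simp add: F_def sum_nonneg)
    ultimately show ?thesis by blast
  qed
  then obtain m where m: "m > 0" "\<And>q. q \<in> W \<Longrightarrow> m * norm q \<le> F q" by blast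
  show ?thesis
  \<comment> \<open>Nonnegativity removes the absolute values in F, and the average formula gives F
    q = card Y * const. The added 1 keeps K positive even for empty Y, where \<open>kern\<close> and
    the trace condition force q = 0.\<close>
  proof (intro exI[of _ "(card Y + 1) / m"] conjI allI impI)
    fix q :: "'n quadratic"
    assume q: "transpose (quad_part q) = quad_part q" "trace (quad_part q) = 0"
      and nn: "\<forall>y\<in>Y. 0 \<le> eval_quadratic q y"
    have "m * norm q \<le> F q" using m q by (simp add: W_def)
    also have F: "F q = card Y * const_part q"
      using nn avg[of q] q by (simp add: F_def)
    also have "\<dots> \<le> (card Y + 1) * const_part q"
    proof -
      have "0 \<le> card Y * const_part q"
        using F by (metis F_def abs_ge_zero sum_nonneg)
      then have "0 \<le> const_part q \<or> card Y = 0" by (auto simp: zero_le_mult_iff)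
      then show ?thesis
      proof
        assume "card Y = 0"
        then have "Y = {}" using fin by simp
        then obtain l where l: "q = l *\<^sub>R sphere_quadratic" using kern[OF q(1)] by blast
        then have "l = 0" using q(2)
          by (simp add: l sphere_quadratic_def quad_part_def trace_scaleR trace_I)
        then show ?thesis using l by (simp add: const_part_def)
      qed (simp add: distrib_right)
    qed
    finally show "norm q \<le> (card Y + 1) / m * const_part q"
      using m(1) by (simp add: field_simps)
  qed (use m in simp)
qed

text \<open>\<open>sphere_quadratic\<close> has minimum -1 and determinant 1, hence H = 1. The last
  conclusion says that H is at most 1 for the perturbed function as well.\<close>

lemma perturbed_sphere_quadratic_bound:
  fixes Y :: "(real^'n) set"
  assumes K: "K > 0" "\<And>q. transpose (quad_part q) = quad_part q \<Longrightarrow> trace (quad_part q) = 0 \<Longrightarrow>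
    (\<And>y. y \<in> Y \<Longrightarrow> 0 \<le> eval_quadratic q y) \<Longrightarrow> norm q \<le> K * const_part q"
  obtains e where "e > 0"
    "\<forall>q. transpose (quad_part q) = quad_part q \<longrightarrow> trace (quad_part q) = 0 \<longrightarrow>
      (\<forall>y\<in>Y. 0 \<le> eval_quadratic q y) \<longrightarrow> norm q < e \<longrightarrow> 0 < det (mat 1 + quad_part q)"
    "\<forall>q y. transpose (quad_part q) = quad_part q \<longrightarrow> trace (quad_part q) = 0 \<longrightarrow>
      (\<forall>y\<in>Y. 0 \<le> eval_quadratic q y) \<longrightarrow> norm q < e \<longrightarrow>
      - root CARD('n) (det (mat 1 + quad_part q)) \<le> eval_quadratic (sphere_quadratic + q) y"
proof -
  obtain D where D: "D \<ge> 0" "\<And>N::real^'n^'n. norm N \<le> 1 \<Longrightarrow> 1 + trace N - D * (norm N)\<^sup>2 \<le> det (mat 1 + N)"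
    using det_one_plus_second_order by blast
  \<comment> \<open>The bound 1/2 keeps |N[y]| below |y|^2 / 2 and stays in the range of the
    determinant estimate. The other bound, with |q| \<le> K d for the constant part d, gives (2 +
    D)|q|^2 \<le> d.\<close>
  define e where "e = min (1 / 2) (1 / ((2 + D) * (K + 1)))"
  have e: "0 < e" using D K by (simp add: e_def)
  have main: "0 < det (mat 1 + quad_part q)"
    "- root CARD('n) (det (mat 1 + quad_part q)) \<le> eval_quadratic (sphere_quadratic + q) y"
    if q: "transpose (quad_part q) = quad_part q" "trace (quad_part q) = 0"
      and nn: "\<forall>y\<in>Y. 0 \<le> eval_quadratic q y" and small: "norm q < e"
    for q y
  proof -
    let ?d = "const_part q" and ?g = "lin_part q" and ?N = "quad_part q"
    let ?x = "norm q"
    have parts: "norm ?g \<le> ?x" "norm ?N \<le> ?x"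
      using norm_fst_le[of "lin_part q" "quad_part q"] norm_snd_le[of "quad_part q" "lin_part q"]
        norm_snd_le[of "snd q" "fst q"] by (simp_all add: lin_part_def quad_part_def)
    have x: "?x \<le> K * ?d" using K(2)[OF q] nn by blast
    have x_half: "?x \<le> 1 / 2" using small by (simp add: e_def)
    have "0 < (2 + D) * (K + 1)" using D(1) K(1) by simp
    moreover have "?x < 1 / ((2 + D) * (K + 1))" using small by (simp add: e_def)
    ultimately have x_small: "(2 + D) * (K + 1) * ?x \<le> 1"
      by (simp only: pos_less_divide_eq mult.commute less_imp_le)
    have d: "0 \<le> ?d" using x K(1) norm_ge_zero[of q] by (metis order_trans zero_le_mult_iff not_less less_le)
    have quadr: "(2 + D) * ?x\<^sup>2 \<le> ?d"
    proof -
      have "(2 + D) * ?x\<^sup>2 = (2 + D) * ?x * ?x" by (simp add: power2_eq_square)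
      also have "\<dots> \<le> (2 + D) * ?x * (K * ?d)" using x D by (intro mult_left_mono) auto
      also have "\<dots> \<le> (2 + D) * ?x * ((K + 1) * ?d)" using D d by (intro mult_left_mono mult_right_mono) auto
      also have "\<dots> = ((2 + D) * (K + 1) * ?x) * ?d" by (simp add: mult_ac)
      also have "\<dots> \<le> 1 * ?d" by (intro mult_right_mono x_small d)
      finally show ?thesis by simp
    qed
    have det_lower: "1 - D * ?x\<^sup>2 \<le> det (mat 1 + ?N)"
    proof -
      have "D * (norm ?N)\<^sup>2 \<le> D * ?x\<^sup>2"
        using D(1) parts(2) by (intro mult_left_mono power_mono) auto
      then show ?thesis using D(2)[of ?N] q(2) parts(2) x_half by linarith
    qed
    have "D * ?x\<^sup>2 < 1"
    proof -
      have "D * ?x\<^sup>2 = (D * ?x) * ?x" by (simp add: power2_eq_square)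
      also have "\<dots> \<le> 1 * ?x"
      proof (rule mult_right_mono)
        have "D * ?x \<le> (2 + D) * (K + 1) * ?x"
          using D(1) K(1) by (intro mult_right_mono) (auto simp: algebra_simps)
        then show "D * ?x \<le> 1" using x_small by linarith
      qed simp
      finally show ?thesis using x_half by simp
    qed
    then show det_pos: "0 < det (mat 1 + ?N)" using det_lower by linarith
    \<comment> \<open>Taking a root does not decrease a number in (0, 1], and a number above 1 has
      root at least 1.\<close>
    have root_lower: "1 - D * ?x\<^sup>2 \<le> root CARD('n) (det (mat 1 + ?N))"
    proof (cases "det (mat 1 + ?N) \<le> 1")
      case True
      have "root 1 (det (mat 1 + ?N)) \<le> root CARD('n) (det (mat 1 + ?N))"
        using det_pos True by (intro real_root_increasing) (simp_all add: Suc_leI)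
      then show ?thesis using det_lower by simp
    next
      case False
      then have "1 \<le> root CARD('n) (det (mat 1 + ?N))" by (simp add: real_root_ge_1_iff)
      then show ?thesis using D(1) by (smt (verit) mult_nonneg_nonneg zero_le_power2)
    qed
    \<comment> \<open>One half of |y|^2 absorbs N[y]; the other half absorbs the linear term by
      completing the square, at the price of 2|g|^2.\<close>
    have "\<bar>quad_form ?N y\<bar> \<le> (norm y)\<^sup>2 / 2"
    proof -
      have "norm ?N * (norm y)\<^sup>2 \<le> 1 / 2 * (norm y)\<^sup>2"
        using parts(2) x_half by (intro mult_right_mono) auto
      then show ?thesis using abs_quad_form_le[of ?N y] by simp
    qed
    moreover have "- (norm ?g * norm y) \<le> ?g \<bullet> y"
      using Cauchy_Schwarz_ineq2[of ?g y] by linarith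
    moreover have "0 \<le> (norm y - 2 * norm ?g)\<^sup>2" by simp
    then have "4 * (norm ?g * norm y) \<le> (norm y)\<^sup>2 + 4 * (norm ?g)\<^sup>2"
      by (simp add: power2_eq_square algebra_simps)
    moreover have "(norm ?g)\<^sup>2 \<le> ?x\<^sup>2" using parts(1) by (intro power_mono) auto
    ultimately have "?d - 1 - 2 * ?x\<^sup>2 \<le> eval_quadratic (sphere_quadratic + q) y"
      unfolding eval_quadratic_add eval_sphere_quadratic eval_quadratic_def[of q] by linarith
    then show "- root CARD('n) (det (mat 1 + ?N)) \<le> eval_quadratic (sphere_quadratic + q) y"
      using quadr root_lower by (simp add: distrib_right)
  qed
  show ?thesis by (rule that[OF e]) (use main in blast)+
qed

section \<open>Passage from the ellipsoid to the unit sphere\<close>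

lemma spherical_design_normalized:
  fixes Q :: "real^'n^'n"
  assumes pd: "positive_definite Q" and design: "carries_spherical_design 4 Q X"
  obtains r c where "r > 0"
    "\<And>q. (\<Sum>x\<in>X. eval_quadratic q ((1 / r) *\<^sub>R (matrix_sqrt Q *v (x - c))))
      = card X * (const_part q + trace (quad_part q) / CARD('n))"
    "\<forall>q. transpose (quad_part q) = quad_part q \<longrightarrow>
      (\<forall>x\<in>X. eval_quadratic q ((1 / r) *\<^sub>R (matrix_sqrt Q *v (x - c))) = 0) \<longrightarrow>
      (\<exists>l. q = l *\<^sub>R sphere_quadratic)"
proof -
  let ?S = "matrix_sqrt Q" let ?T = "matrix_inv ?S"
  obtain c r where r: "r > 0" and des: "\<And>p. poly_fun_deg_le 4 p \<Longrightarrow>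
    (1 / real (card X)) * (\<Sum>x\<in>X. p x) = (\<integral>x. p x \<partial>ellipsoid_measure Q c r)"
    using design unfolding carries_spherical_design_def by blast
  have fin: "finite X" using design by (simp add: carries_spherical_design_def)
  \<comment> \<open>\<open>?G\<close> is the parametrization in \<open>ellipsoid_measure\<close> and
    \<open>?L\<close> undoes it, so averages over X of functions of \<open>?L x\<close> become
    integrals over the unit sphere.\<close>
  let ?L = "\<lambda>x. (1 / r) *\<^sub>R (?S *v (x - c))"
  let ?G = "\<lambda>y. c + r *\<^sub>R (?T *v y)"
  have ST: "?S ** ?T = mat 1"
    by (rule positive_definite_inverse(1)[OF matrix_sqrt(1)[OF pd]])
  have LG: "?L (?G y) = y" for y
    using r by (simp add: matrix_vector_mult_scaleR matrix_vector_mul_assoc ST)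
  have G: "?G \<in> borel_measurable unit_sphere_measure"
  proof -
    have "continuous_on UNIV ?G"
      by (intro continuous_intros bounded_linear.continuous_on[OF matrix_vector_mul_bounded_linear])
    then show ?thesis
      using borel_measurable_continuous_onI by (simp cong: measurable_cong_sets)
  qed
  have L: "?L x $ i = - ((1 / r) * (?S $ i \<bullet> c)) + ((1 / r) *\<^sub>R ?S $ i) \<bullet> x" for x i
    by (simp add: matrix_vector_mul_component inner_diff_right algebra_simps)
  have avg: "(1 / real (card X)) * (\<Sum>x\<in>X. h (?L x)) = (\<integral>y. h y \<partial>unit_sphere_measure)"
    if "poly_fun_deg_le 4 (\<lambda>x. h (?L x))" "continuous_on UNIV h" for h
  proof -
    have "continuous_on UNIV (\<lambda>x. h (?L x))"
      by (intro continuous_on_compose2[OF that(2)] continuous_intros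
          bounded_linear.continuous_on[OF matrix_vector_mul_bounded_linear]) auto
    then have "(\<lambda>x. h (?L x)) \<in> borel_measurable borel"
      by (rule borel_measurable_continuous_onI)
    then have "(\<integral>x. h (?L x) \<partial>ellipsoid_measure Q c r) = (\<integral>y. h (?L (?G y)) \<partial>unit_sphere_measure)"
      unfolding ellipsoid_measure_def using G by (intro integral_distr) auto
    then show ?thesis using des[OF that(1)] by (simp only: LG)
  qed
  have poly2: "poly_fun_deg_le 2 (\<lambda>x. eval_quadratic q (?L x))" for q
    using poly_fun_deg_le_quadratic_times[OF poly_fun_deg_le_const[of 0 1] L, of q] by (simp add: numeral_2_eq_2)
  have poly4: "poly_fun_deg_le 4 (\<lambda>x. (eval_quadratic q (?L x))\<^sup>2)" for q
    using poly_fun_deg_le_quadratic_times[OF poly2 L, of q] by (simp add: power2_eq_square)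
  have avg1: "(1 / real (card X)) * (\<Sum>x\<in>X. eval_quadratic q (?L x))
      = const_part q + trace (quad_part q) / CARD('n)" for q
    unfolding integral_unit_sphere_measure_quadratic[symmetric]
    by (rule avg[OF poly_fun_deg_le_mono[OF poly2]]) (simp, intro continuous_intros)
  \<comment> \<open>For the constant 1 an empty X would give average 0, division by zero being 0,
    against the integral 1.\<close>
  have card: "card X \<noteq> 0"
  proof
    assume "card X = 0"
    then show False using avg1[of "(1, 0, 0)"] by (simp add: const_part_def quad_part_def trace_def)
  qed
  show ?thesis
  proof (rule that[OF r])
    show "(\<Sum>x\<in>X. eval_quadratic q (?L x)) = card X * (const_part q + trace (quad_part q) / CARD('n))" for q
      using avg1[of q] card by (simp add: field_simps)
    have "\<exists>l. q = l *\<^sub>R sphere_quadratic"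
      if sym: "transpose (quad_part q) = quad_part q" and zero: "\<forall>x\<in>X. eval_quadratic q (?L x) = 0" for q
    proof -
    have cont: "continuous_on UNIV (\<lambda>y. (eval_quadratic q y)\<^sup>2)" by (intro continuous_intros)
    \<comment> \<open>This is where strength 4 of the design enters: the square of q has degree 4
      and average 0 over X.\<close>
    have "(\<integral>y. (eval_quadratic q y)\<^sup>2 \<partial>unit_sphere_measure) = 0"
      using avg[OF poly4 cont] zero by simp
    then have "(eval_quadratic q y)\<^sup>2 = 0" if "norm y = 1" for y
      using unit_sphere_measure_full_support[OF cont _ _ that] by simp
    then have "q = (- const_part q) *\<^sub>R sphere_quadratic"
      by (intro quadratic_vanishing_on_sphere sym) simp
    then show ?thesis by blast
    qed
    then show "\<forall>q. transpose (quad_part q) = quad_part q \<longrightarrow>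
      (\<forall>x\<in>X. eval_quadratic q (?L x) = 0) \<longrightarrow> (\<exists>l. q = l *\<^sub>R sphere_quadratic)"
      by blast
  qed
qed

text \<open>For symmetric T and symmetric quadratic part these are the coefficients of g(c + r T y)
  as a function of y. Working on coefficients makes the map linear in g, hence continuous.\<close>

definition affine_pullback :: "real^'n \<Rightarrow> real \<Rightarrow> real^'n^'n \<Rightarrow> 'n::finite quadratic \<Rightarrow> 'n quadratic" where
  "affine_pullback c r T g = (eval_quadratic g c,
     r *\<^sub>R (T *v (lin_part g + quad_part g *v c)), r\<^sup>2 *\<^sub>R (T ** quad_part g ** T))"

lemma linear_affine_pullback: "linear (affine_pullback c r T)"
proof (rule linearI)
  have mal: "(X + Y) ** Z = X ** Z + Y ** Z" for X Y Z :: "real^'n^'n"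
    by (simp_all add: vec_eq_iff matrix_matrix_mult_def sum.distrib algebra_simps)
  show "affine_pullback c r T (p + q) = affine_pullback c r T p + affine_pullback c r T q" for p q
    by (simp add: affine_pullback_def eval_quadratic_add lin_part_def quad_part_def
        mal matrix_add_ldistrib algebra_simps)
  show "affine_pullback c r T (k *\<^sub>R q) = k *\<^sub>R affine_pullback c r T q" for k q
    by (simp add: affine_pullback_def eval_quadratic_scaleR lin_part_def quad_part_def
        scaleR_matrix_mult_left scaleR_matrix_mult_right scaleR_matrix_vector
        matrix_vector_mult_scaleR algebra_simps)
qed

lemma affine_pullback_parts:
  "const_part (affine_pullback c r T g) = eval_quadratic g c"
  "lin_part (affine_pullback c r T g) = r *\<^sub>R (T *v (lin_part g + quad_part g *v c))"
  "quad_part (affine_pullback c r T g) = r\<^sup>2 *\<^sub>R (T ** quad_part g ** T)"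
  by (simp_all add: affine_pullback_def const_part_def lin_part_def quad_part_def)

lemma eval_affine_pullback:
  assumes T: "transpose T = T" and P: "transpose (quad_part g) = quad_part g"
  shows "eval_quadratic (affine_pullback c r T g) y = eval_quadratic g (c + r *\<^sub>R (T *v y))"
proof -
  let ?P = "quad_part g" let ?z = "T *v y"
  have "quad_form ?P (c + r *\<^sub>R ?z) = quad_form ?P c + 2 * r * ((?P *v c) \<bullet> ?z) + r\<^sup>2 * quad_form ?P ?z"
    using symmetric_matrix_inner_swap[OF P, of c ?z]
    by (simp add: quad_form_def algebra_simps power2_eq_square matrix_vector_mult_scaleR inner_commute)
  moreover have "(T *v u) \<bullet> y = u \<bullet> ?z" for u
    using symmetric_matrix_inner_swap[OF T] by metis
  ultimately show ?thesis
    unfolding eval_quadratic_def[of "affine_pullback c r T g"] affine_pullback_parts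
      quad_form_scaleR quad_form_congruence[OF T, symmetric]
    by (simp add: eval_quadratic_def algebra_simps)
qed

section \<open>Comparison of H near a strongly perfect function\<close>

theorem theorem4p5:
  fixes f :: "'n::finite quadratic"
  assumes "strongly_perfect f"
  shows "extreme f"
proof -
  let ?n = "CARD('n)"
  define Q where "Q = quad_part f"
  define S where "S = matrix_sqrt Q"
  define T where "T = matrix_inv S"
  define X where "X = {v. v extreme_point_of Del f}"
  have fE: "f \<in> erdahl_pos" and design: "carries_spherical_design 4 Q X"
    using assms by (auto simp: strongly_perfect_def X_def Q_def)
  have pd: "positive_definite Q" using fE by (simp add: erdahl_pos_def Q_def)
  have SS: "S ** S = Q" and ST: "S ** T = mat 1" and TS: "T ** S = mat 1"
    and symT: "transpose T = T"
    using matrix_sqrt[OF pd] positive_definite_inverse[OF matrix_sqrt(1)[OF pd]]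
    unfolding S_def T_def by (simp_all add: positive_definite_def)
  \<comment> \<open>Extreme points of a convex hull belong to the generating set, so the vertices
    are lattice zeros of f.\<close>
  have X: "x \<in> int_lattice" "eval_quadratic f x = 0" if "x \<in> X" for x
    using that extreme_point_of_convex_hull unfolding X_def Del_def by blast+
  obtain r c where r: "r > 0"
    and avg: "\<And>q. (\<Sum>x\<in>X. eval_quadratic q ((1 / r) *\<^sub>R (S *v (x - c))))
      = card X * (const_part q + trace (quad_part q) / ?n)"
    and kern: "\<forall>q. transpose (quad_part q) = quad_part q \<longrightarrow>
      (\<forall>x\<in>X. eval_quadratic q ((1 / r) *\<^sub>R (S *v (x - c))) = 0) \<longrightarrow>
      (\<exists>l. q = l *\<^sub>R sphere_quadratic)"
    by (rule spherical_design_normalized[OF pd design, folded S_def]) (rule that)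
  define L where "L x = (1 / r) *\<^sub>R (S *v (x - c))" for x
  define G where "G y = c + r *\<^sub>R (T *v y)" for y
  define pull where "pull = affine_pullback c r T"
  have GL: "G (L x) = x" for x
    using r by (simp add: G_def L_def matrix_vector_mult_scaleR matrix_vector_mul_assoc TS)
  have pull: "eval_quadratic (pull g) (L x) = eval_quadratic g x"
    if "transpose (quad_part g) = quad_part g" for g x
    using eval_affine_pullback[OF symT that, of c r "L x"] GL[of x] by (simp add: pull_def G_def)
  have quad_pull: "quad_part (pull g) = r\<^sup>2 *\<^sub>R (T ** quad_part g ** T)" for g
    by (simp add: pull_def affine_pullback_parts)
  have sym_pull: "transpose (quad_part (pull g)) = quad_part (pull g)"
    if "transpose (quad_part g) = quad_part g" for g
    using that by (simp add: quad_pull transpose_scalar transpose_congruence symT)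
  define Y where "Y = L ` X"
  have "inj_on L X" by (metis GL inj_on_inverseI)
  then have avgY: "(\<Sum>y\<in>Y. eval_quadratic q y) = card Y * (const_part q + trace (quad_part q) / ?n)" for q
    using avg[of q, folded L_def] by (simp add: Y_def sum.reindex card_image)
  have kernY: "\<exists>l. q = l *\<^sub>R sphere_quadratic"
    if "transpose (quad_part q) = quad_part q" "\<And>y. y \<in> Y \<Longrightarrow> eval_quadratic q y = 0" for q
  proof -
    have "\<forall>x\<in>X. eval_quadratic q ((1 / r) *\<^sub>R (S *v (x - c))) = 0"
      using that(2) unfolding Y_def L_def by blast
    then show ?thesis using kern that(1) by blast
  qed
  have finY: "finite Y"
    using design by (simp add: Y_def carries_spherical_design_def)
  obtain K where K: "K > 0" "\<And>q. transpose (quad_part q) = quad_part q \<Longrightarrow> trace (quad_part q) = 0 \<Longrightarrow>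
    (\<And>y. y \<in> Y \<Longrightarrow> 0 \<le> eval_quadratic q y) \<Longrightarrow> norm q \<le> K * const_part q"
    using norm_quadratic_le_const_part[OF finY avgY kernY] by blast
  obtain e where e: "e > 0" and det_pos:
    "\<forall>q. transpose (quad_part q) = quad_part q \<longrightarrow> trace (quad_part q) = 0 \<longrightarrow>
      (\<forall>y\<in>Y. 0 \<le> eval_quadratic q y) \<longrightarrow> norm q < e \<longrightarrow> 0 < det (mat 1 + quad_part q)"
    and lower:
    "\<forall>q y. transpose (quad_part q) = quad_part q \<longrightarrow> trace (quad_part q) = 0 \<longrightarrow>
      (\<forall>y\<in>Y. 0 \<le> eval_quadratic q y) \<longrightarrow> norm q < e \<longrightarrow>
      - root ?n (det (mat 1 + quad_part q)) \<le> eval_quadratic (sphere_quadratic + q) y"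
    by (rule perturbed_sphere_quadratic_bound[OF K])
  have symQ: "transpose (quad_part f) = quad_part f" using pd by (simp add: positive_definite_def Q_def)
  have TQT: "T ** Q ** T = mat 1"
  proof -
    have "T ** Q ** T = (T ** S) ** (S ** T)" by (simp add: SS[symmetric] matrix_mul_assoc)
    then show ?thesis by (simp add: ST TS)
  qed
  \<comment> \<open>The pullback of f vanishes on Y, hence is a multiple of
    \<open>sphere_quadratic\<close>; comparing traces of quadratic parts identifies the
    factor.\<close>
  have pull_f: "pull f = r\<^sup>2 *\<^sub>R sphere_quadratic"
  proof -
    have "\<exists>l. pull f = l *\<^sub>R sphere_quadratic"
      by (rule kernY[OF sym_pull[OF symQ]]) (auto simp: Y_def pull[OF symQ] X)
    then obtain l where l: "pull f = l *\<^sub>R sphere_quadratic" ..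
    have "quad_part (pull f) = r\<^sup>2 *\<^sub>R mat 1"
      using quad_pull[of f] TQT by (simp add: Q_def)
    then have "trace (l *\<^sub>R mat 1 :: real^'n^'n) = trace (r\<^sup>2 *\<^sub>R mat 1 :: real^'n^'n)"
      by (simp only: l quad_part_def sphere_quadratic_def snd_scaleR snd_conv)
    then have "l = r\<^sup>2" by (simp add: trace_scaleR trace_I)
    then show ?thesis using l by simp
  qed
  have detQ: "det Q = det S * det S" by (simp add: SS[symmetric] det_mul)
  have "det S * det T = 1" using arg_cong[OF ST, of det] by (simp add: det_mul)
  then have "det S \<noteq> 0" by auto
  then have detQ_pos: "0 < det Q" by (auto simp: detQ zero_less_mult_iff)
  \<comment> \<open>The value of f at the centre c is -r^2. The infimum over the reals is only
    meaningful once f is known to be bounded below.\<close>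
  have H_f: "r\<^sup>2 / root ?n (det Q) \<le> H f"
  proof -
    have "- r\<^sup>2 \<le> eval_quadratic f x" for x
    proof -
      have "eval_quadratic f x = r\<^sup>2 * (norm (L x))\<^sup>2 - r\<^sup>2"
        using pull[OF symQ, of x]
        by (simp add: pull_f eval_quadratic_scaleR eval_sphere_quadratic right_diff_distrib)
      then show ?thesis by simp
    qed
    then have bdd: "bdd_below (range (eval_quadratic f))" by (intro bdd_belowI2)
    have "eval_quadratic f c = - r\<^sup>2"
      using pull[OF symQ, of c] by (simp add: pull_f L_def eval_quadratic_scaleR eval_sphere_quadratic)
    then have "(INF x. eval_quadratic f x) \<le> - r\<^sup>2"
      using cINF_lower[OF bdd, of c] by simp
    then have "r\<^sup>2 \<le> mu f" by (simp add: mu_def)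
    then show ?thesis
      unfolding H_def Q_def[symmetric] using detQ_pos by (intro divide_right_mono) auto
  qed
  \<comment> \<open>Dividing by the mean diagonal entry s makes q trace-free; this is the
    normalization allowed by the scale invariance of H.\<close>
  define s where "s g = trace (quad_part (pull g)) / ?n" for g
  define q where "q g = (1 / s g) *\<^sub>R pull g - sphere_quadratic" for g
  have s_f: "s f = r\<^sup>2"
    by (simp add: s_def pull_f) (simp add: quad_part_def sphere_quadratic_def trace_scaleR trace_I)
  have q_f: "q f = 0" using r by (simp add: q_def s_f pull_f)
  \<comment> \<open>Continuity of the linear pullback carries over to s and q, since s f = r^2 is
    nonzero; so s stays positive and q small near f.\<close>
  have lim_pull: "(pull \<longlongrightarrow> pull f) (nhds f)"
    unfolding pull_def tendsto_at_iff_tendsto_nhds[symmetric]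
    using linear_affine_pullback[of c r T]
    by (intro isContD linear_continuous_at) (simp add: linear_conv_bounded_linear)
  have lim_s: "(s \<longlongrightarrow> s f) (nhds f)"
    unfolding s_def trace_def quad_part_def by (intro tendsto_intros lim_pull) simp
  have lim_q: "(q \<longlongrightarrow> q f) (nhds f)"
    unfolding q_def by (intro tendsto_intros lim_pull lim_s) (use r s_f in simp)
  have "\<forall>\<^sub>F g in nhds f. 0 < s g"
    using order_tendstoD(1)[OF lim_s, of 0] r by (simp add: s_f)
  moreover have "\<forall>\<^sub>F g in nhds f. norm (q g) < e"
    using tendstoD[OF lim_q e] by (simp add: q_f)
  ultimately have "\<forall>\<^sub>F g in nhds f. g \<noteq> f \<longrightarrow> g \<in> erdahl_pos \<longrightarrow> H g \<le> H f"
  proof eventually_elim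
    case (elim g)
    show ?case
    proof (intro impI)
      assume g: "g \<in> erdahl_pos"
      let ?M = "quad_part (pull g)" and ?R = "root ?n (det (mat 1 + quad_part (q g)))"
      have symg: "transpose (quad_part g) = quad_part g"
        using g by (simp add: erdahl_pos_def positive_definite_def)
      have quad_q: "quad_part (q g) = (1 / s g) *\<^sub>R ?M - mat 1"
        by (simp add: q_def quad_part_def sphere_quadratic_def)
      have eval: "eval_quadratic (sphere_quadratic + q g) y = eval_quadratic (pull g) y / s g" for y
        by (simp add: q_def eval_quadratic_scaleR)
      have sym_q: "transpose (quad_part (q g)) = quad_part (q g)"
        using sym_pull[OF symg] by (simp add: quad_q transpose_def vec_eq_iff mat_def)
      have tr_q: "trace (quad_part (q g)) = 0"
      proof -
        have "trace ?M = s g * ?n" by (simp add: s_def)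
        then show ?thesis using elim(1) by (simp add: quad_q trace_sub trace_scaleR trace_I)
      qed
      \<comment> \<open>On Y the function \<open>sphere_quadratic\<close> is zero, so q has the sign
        of g at a vertex, and vertices are lattice points.\<close>
      have nn_q: "0 \<le> eval_quadratic (q g) y" if y: "y \<in> Y" for y
      proof -
        obtain x where x: "x \<in> X" "y = L x" using y by (auto simp: Y_def)
        have "eval_quadratic sphere_quadratic y = 0"
          using pull[OF symQ, of x] X(2)[OF x(1)] r by (simp add: x pull_f eval_quadratic_scaleR)
        moreover have "0 \<le> eval_quadratic g x"
          using g X(1)[OF x(1)] by (simp add: erdahl_pos_def)
        ultimately show ?thesis
          using eval[of y] elim(1) pull[OF symg, of x] by (simp add: eval_quadratic_add x)
      qed
      have detN: "0 < det (mat 1 + quad_part (q g))"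
        using det_pos sym_q tr_q nn_q elim(2) by blast
      then have R: "0 < ?R" by simp
      have "- (s g * ?R) \<le> eval_quadratic g x" for x
      proof -
        have "- ?R \<le> eval_quadratic g x / s g"
          using lower[rule_format, OF sym_q tr_q nn_q elim(2), of "L x"] by (simp add: eval pull[OF symg])
        then show ?thesis using elim(1) by (simp add: field_simps)
      qed
      then have "- (s g * ?R) \<le> (INF x. eval_quadratic g x)"
        by (intro cINF_greatest) auto
      then have mu: "mu g \<le> s g * ?R" by (simp add: mu_def)
      \<comment> \<open>Undoing the pullback with S as inverse of T expresses the determinant of g
        through that of 1 + N, where N is the quadratic part of q.\<close>
      have "quad_part g = (s g / r\<^sup>2) *\<^sub>R (S ** (mat 1 + quad_part (q g)) ** S)"
      proof -
        have "S ** (T ** quad_part g ** T) ** S = (S ** T) ** quad_part g ** (T ** S)"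
          by (simp add: matrix_mul_assoc)
        also have "\<dots> = quad_part g" by (simp add: ST TS)
        finally show ?thesis
          using elim(1) r by (simp add: quad_q quad_pull scaleR_matrix_mult_left scaleR_matrix_mult_right)
      qed
      then have "det (quad_part g) = (s g / r\<^sup>2) ^ ?n * (det Q * det (mat 1 + quad_part (q g)))"
        by (simp add: det_scaleR det_mul detQ mult_ac)
      then have root_g: "root ?n (det (quad_part g)) = s g / r\<^sup>2 * (root ?n (det Q) * ?R)"
        using elim(1) by (simp add: real_root_mult real_root_power_cancel)
      \<comment> \<open>The upper bound for mu and the root of the determinant share the factors s
        and \<open>?R\<close>; cancelling them leaves the lower bound for H f.\<close>
      have "H g \<le> s g * ?R / (s g / r\<^sup>2 * (root ?n (det Q) * ?R))"
        unfolding H_def root_g using elim(1) R detQ_pos r by (intro divide_right_mono mu) simp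
      also have "\<dots> = r\<^sup>2 / root ?n (det Q)"
        using elim(1) R r by (simp add: field_simps)
      finally show "H g \<le> H f" using H_f by linarith
    qed
  qed
  then show ?thesis using fE by (simp add: extreme_def eventually_at_filter)
qed

end
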